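(* Let $d\geq 2$, $N\geq 1$, let $A,B\in\mathbb{C}^{N,N}$ be simultaneously diagonalizable (over $\mathbb{C}$), let every eigenvalue of $A$ have positive real part, and let $S\in\mathbb{R}^{d,d}$ be skew-symmetric. Let $1\leq p\leq\infty$ and let $\theta\in C(\mathbb{R}^d,\mathbb{R})$ be a radial weight function of exponential growth rate $\eta\geq 0$. Then the operators $(T(t))_{t\geq0}$ given by $$[T(t)v](x)=\begin{cases}\int_{\mathbb{R}^d}H(x,\xi,t)v(\xi)\,d\xi,&t>0,\\ v(x),&t=0,\end{cases}\qquad x\in\mathbb{R}^d,$$ with $$H(x,\xi,t)=(4\pi tA)^{-\frac d2}\exp\left(-Bt-(4tA)^{-1}|e^{tS}x-\xi|^2\right),$$ form a semigroup on $L^p_\theta(\mathbb{R}^d,\mathbb{C}^N)$; that is, $T(t):L^p_\theta(\mathbb{R}^d,\mathbb{C}^N)\to L^p_\theta(\mathbb{R}^d,\mathbb{C}^N)$ is linear and bounded for every $t\geq0$, $T(0)=I$, and $T(t)T(s)=T(t+s)$ for all $s,t\geq0$.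
   Context: A function $\theta\in C(\mathbb{R}^d,\mathbb{R})$ is a weight function of exponential growth rate $\eta\geq0$ if $\theta(x)>0$ for all $x$ and there is $C_\theta>0$ with $\theta(x+y)\leq C_\theta\theta(x)e^{\eta|y|}$ for all $x,y\in\mathbb{R}^d$. It is radial if there is $\phi:[0,\infty)\to\mathbb{R}$ with $\theta(x)=\phi(|x|)$ for all $x$. $L^p_\theta(\mathbb{R}^d,\mathbb{C}^N)=\{v\in L^1_{\mathrm{loc}}(\mathbb{R}^d,\mathbb{C}^N):\|\theta v\|_{L^p}<\infty\}$ with norm $\|v\|_{L^p_\theta}=\|\theta v\|_{L^p}$. Matrix powers: if $A=Y\,\mathrm{diag}(\lambda_k)\,Y^{-1}$ then $(4\pi tA)^{-d/2}=Y\,\mathrm{diag}\big((4\pi t\lambda_k)^{-d/2}\big)\,Y^{-1}$, with $z^{-d/2}=\exp(-\frac d2\mathrm{Log}\,z)$ and $\mathrm{Log}$ the principal logarithm. *)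

theory Defs
  imports "HOL-Analysis.Analysis" "HOL-Probability.Essential_Supremum"
begin

section \<open>Matrices\<close>

definition diag_matrix :: "('n \<Rightarrow> 'a::zero) \<Rightarrow> 'a ^ 'n ^ 'n"
  where "diag_matrix l = (\<chi> i j. if i = j then l i else 0)"

definition simultaneously_diagonalizable :: "complex ^ 'n ^ 'n \<Rightarrow> complex ^ 'n ^ 'n \<Rightarrow> bool"
  where "simultaneously_diagonalizable A B \<longleftrightarrow>
    (\<exists>(Y :: complex ^ 'n ^ 'n) l m. invertible Y \<and>
       A = Y ** diag_matrix l ** matrix_inv Y \<and> B = Y ** diag_matrix m ** matrix_inv Y)"

definition eigenvalue :: "complex ^ 'n ^ 'n \<Rightarrow> complex \<Rightarrow> bool"
  where "eigenvalue A z \<longleftrightarrow> (\<exists>v. v \<noteq> 0 \<and> A *v v = z *s v)"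

text \<open>The multiplication \<open>(*)\<close> on \<^typ>\<open>'a ^ 'n ^ 'n\<close> is componentwise, so the library's
  \<^const>\<open>exp\<close> and \<open>(^)\<close> are not the matrix operations; powers are iterated \<open>(**)\<close>.\<close>

definition matrix_exp :: "'a::real_normed_algebra_1 ^ 'n ^ 'n \<Rightarrow> 'a ^ 'n ^ 'n"
  where "matrix_exp M = (\<Sum>k. (((**) M) ^^ k) (mat 1) /\<^sub>R fact k)"

text \<open>Principal-branch power of a diagonalizable matrix. On complex numbers, \<open>powr\<close> is
  \<open>exp (s * Ln z)\<close> with the principal logarithm for \<open>z \<noteq> 0\<close>. The lemma below shows that the value
  does not depend on the diagonalization; nothing is meant for non-diagonalizable \<open>M\<close>.\<close>

definition matrix_cpow :: "complex ^ 'n ^ 'n \<Rightarrow> complex \<Rightarrow> complex ^ 'n ^ 'n"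
  where "matrix_cpow M s = (THE R. \<exists>(Y :: complex ^ 'n ^ 'n) l. invertible Y \<and>
    M = Y ** diag_matrix l ** matrix_inv Y \<and>
    R = Y ** diag_matrix (\<lambda>k. l k powr s) ** matrix_inv Y)"

lemma diag_matrix_mult_left: "(diag_matrix l ** M) $ i $ j = l i * (M :: 'a::comm_semiring_1 ^ 'n ^ 'n) $ i $ j"
proof -
  have "(\<Sum>k\<in>UNIV. (if i = k then l i else 0) * M $ k $ j) = (\<Sum>k\<in>UNIV. if i = k then l i * M $ k $ j else 0)"
    by (rule sum.cong) auto
  then show ?thesis by (simp add: diag_matrix_def matrix_matrix_mult_def)
qed

lemma diag_matrix_mult_right: "(M ** diag_matrix l) $ i $ j = (M :: 'a::comm_semiring_1 ^ 'n ^ 'n) $ i $ j * l j"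
proof -
  have "(\<Sum>k\<in>UNIV. M $ i $ k * (if k = j then l k else 0)) = (\<Sum>k\<in>UNIV. if k = j then M $ i $ k * l k else 0)"
    by (rule sum.cong) auto
  then show ?thesis by (simp add: diag_matrix_def matrix_matrix_mult_def)
qed

lemma matrix_cpow_diag:
  fixes Y :: "complex ^ 'n ^ 'n"
  assumes Y: "invertible Y"
  shows "matrix_cpow (Y ** diag_matrix l ** matrix_inv Y) s =
    Y ** diag_matrix (\<lambda>k. l k powr s) ** matrix_inv Y"
  unfolding matrix_cpow_def
proof (rule the_equality)
  show "\<exists>(Z :: complex ^ 'n ^ 'n) m. invertible Z \<and> Y ** diag_matrix l ** matrix_inv Y = Z ** diag_matrix m ** matrix_inv Z \<and>
     Y ** diag_matrix (\<lambda>k. l k powr s) ** matrix_inv Y = Z ** diag_matrix (\<lambda>k. m k powr s) ** matrix_inv Z"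
    using Y by blast
next
  fix R
  assume "\<exists>(Z :: complex ^ 'n ^ 'n) m. invertible Z \<and> Y ** diag_matrix l ** matrix_inv Y = Z ** diag_matrix m ** matrix_inv Z \<and>
     R = Z ** diag_matrix (\<lambda>k. m k powr s) ** matrix_inv Z"
  then obtain Z :: "complex ^ 'n ^ 'n" and m where Z: "invertible Z"
    and eq: "Y ** diag_matrix l ** matrix_inv Y = Z ** diag_matrix m ** matrix_inv Z"
    and R: "R = Z ** diag_matrix (\<lambda>k. m k powr s) ** matrix_inv Z" by blast
  have YY: "Y ** matrix_inv Y = mat 1" "matrix_inv Y ** Y = mat 1"
    and ZZ: "Z ** matrix_inv Z = mat 1" "matrix_inv Z ** Z = mat 1"
    using someI_ex[OF Y[unfolded invertible_def]] someI_ex[OF Z[unfolded invertible_def]]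
    by (simp_all add: matrix_inv_def)
  define P where "P = matrix_inv Z ** Y"
  have "matrix_inv Z ** (Y ** diag_matrix l ** matrix_inv Y) ** Y =
        matrix_inv Z ** (Z ** diag_matrix m ** matrix_inv Z) ** Y"
    using eq by simp
  then have "P ** diag_matrix l = diag_matrix m ** P"
    unfolding P_def using YY ZZ
    by (metis matrix_mul_assoc matrix_mul_lid matrix_mul_rid)
  then have *: "P $ i $ j * l j = m i * P $ i $ j" for i j
    by (metis diag_matrix_mult_left diag_matrix_mult_right)
  have "P ** diag_matrix (\<lambda>k. l k powr s) = diag_matrix (\<lambda>k. m k powr s) ** P"
    unfolding vec_eq_iff diag_matrix_mult_left diag_matrix_mult_right
    using * by (metis mult.commute mult_cancel_left)
  then have "Z ** (P ** diag_matrix (\<lambda>k. l k powr s)) ** matrix_inv Y =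
             Z ** (diag_matrix (\<lambda>k. m k powr s) ** P) ** matrix_inv Y"
    by simp
  then show "R = Y ** diag_matrix (\<lambda>k. l k powr s) ** matrix_inv Y"
    unfolding P_def R using YY ZZ
    by (metis matrix_mul_assoc matrix_mul_lid matrix_mul_rid)
qed

section \<open>Weighted Lebesgue spaces\<close>

definition weight_function :: "('a::real_normed_vector \<Rightarrow> real) \<Rightarrow> real \<Rightarrow> bool"
  where "weight_function \<theta> \<eta> \<longleftrightarrow>
    continuous_on UNIV \<theta> \<and> \<eta> \<ge> 0 \<and> (\<forall>x. \<theta> x > 0) \<and>
    (\<exists>C>0. \<forall>x y. \<theta> (x + y) \<le> C * \<theta> x * exp (\<eta> * norm y))"

definition radial :: "('a::real_normed_vector \<Rightarrow> real) \<Rightarrow> bool"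
  where "radial \<theta> \<longleftrightarrow> (\<exists>\<phi>::real \<Rightarrow> real. \<forall>x. \<theta> x = \<phi> (norm x))"

definition locally_integrable :: "('a::euclidean_space \<Rightarrow> 'b::euclidean_space) \<Rightarrow> bool"
  where "locally_integrable v \<longleftrightarrow>
    v \<in> borel_measurable lebesgue \<and> (\<forall>K. compact K \<longrightarrow> v absolutely_integrable_on K)"

definition Lp_norm :: "ennreal \<Rightarrow> ('a::euclidean_space \<Rightarrow> 'b::real_normed_vector) \<Rightarrow> ennreal"
  where "Lp_norm p f =
    (if p = \<infinity> then esssup lebesgue (\<lambda>x. ennreal (norm (f x)))
     else let I = \<integral>\<^sup>+x. ennreal (norm (f x) powr enn2real p) \<partial>lebesgue
          in if I = \<infinity> then \<infinity> else ennreal (enn2real I powr (1 / enn2real p)))"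

definition weighted_Lp_norm ::
  "ennreal \<Rightarrow> ('a::euclidean_space \<Rightarrow> real) \<Rightarrow> ('a \<Rightarrow> 'b::real_normed_vector) \<Rightarrow> ennreal"
  where "weighted_Lp_norm p \<theta> v = Lp_norm p (\<lambda>x. \<theta> x *\<^sub>R v x)"

text \<open>Elements are represented by functions; equality of elements is \<open>ae_equal\<close>.\<close>

definition weighted_Lp ::
  "ennreal \<Rightarrow> ('a::euclidean_space \<Rightarrow> real) \<Rightarrow> ('a \<Rightarrow> 'b::euclidean_space) set"
  where "weighted_Lp p \<theta> = {v. locally_integrable v \<and> weighted_Lp_norm p \<theta> v < \<infinity>}"

definition ae_equal :: "('a::euclidean_space \<Rightarrow> 'b) \<Rightarrow> ('a \<Rightarrow> 'b) \<Rightarrow> bool"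
  where "ae_equal v w \<longleftrightarrow> (AE x in lebesgue. v x = w x)"

text \<open>A map of representatives induces a complex linear operator, respectively a bounded
  operator, on the space of almost-everywhere classes.\<close>

definition linear_operator_on_Lp ::
  "ennreal \<Rightarrow> ('a::euclidean_space \<Rightarrow> real) \<Rightarrow>
   (('a \<Rightarrow> complex ^ 'n) \<Rightarrow> 'a \<Rightarrow> complex ^ 'n) \<Rightarrow> bool"
  where "linear_operator_on_Lp p \<theta> F \<longleftrightarrow>
    (\<forall>v \<in> weighted_Lp p \<theta>. F v \<in> weighted_Lp p \<theta>) \<and>
    (\<forall>v \<in> weighted_Lp p \<theta>. \<forall>w \<in> weighted_Lp p \<theta>. ae_equal v w \<longrightarrow> ae_equal (F v) (F w)) \<and>
    (\<forall>v \<in> weighted_Lp p \<theta>. \<forall>w \<in> weighted_Lp p \<theta>.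
       ae_equal (F (\<lambda>x. v x + w x)) (\<lambda>x. F v x + F w x)) \<and>
    (\<forall>c. \<forall>v \<in> weighted_Lp p \<theta>. ae_equal (F (\<lambda>x. c *s v x)) (\<lambda>x. c *s F v x))"

definition bounded_operator_on_Lp ::
  "ennreal \<Rightarrow> ('a::euclidean_space \<Rightarrow> real) \<Rightarrow>
   (('a \<Rightarrow> complex ^ 'n) \<Rightarrow> 'a \<Rightarrow> complex ^ 'n) \<Rightarrow> bool"
  where "bounded_operator_on_Lp p \<theta> F \<longleftrightarrow>
    (\<exists>C::real. C \<ge> 0 \<and> (\<forall>v \<in> weighted_Lp p \<theta>.
       weighted_Lp_norm p \<theta> (F v) \<le> ennreal C * weighted_Lp_norm p \<theta> v))"

section \<open>The Ornstein--Uhlenbeck operators\<close>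

definition OU_kernel ::
  "complex ^ 'n ^ 'n \<Rightarrow> complex ^ 'n ^ 'n \<Rightarrow> real ^ 'd ^ 'd \<Rightarrow>
   real ^ 'd \<Rightarrow> real ^ 'd \<Rightarrow> real \<Rightarrow> complex ^ 'n ^ 'n"
  where "OU_kernel A B S x \<xi> t =
    matrix_cpow ((4 * pi * t) *\<^sub>R A) (- of_nat CARD('d) / 2) **
    matrix_exp (- (t *\<^sub>R B)
      - (norm (matrix_exp (t *\<^sub>R S) *v x - \<xi>))\<^sup>2 *\<^sub>R matrix_inv ((4 * t) *\<^sub>R A))"

text \<open>Only \<open>t \<ge> 0\<close> is meaningful. The Bochner integral is \<open>0\<close> by convention when the
  integrand is not integrable.\<close>

definition OU_semigroup ::
  "complex ^ 'n ^ 'n \<Rightarrow> complex ^ 'n ^ 'n \<Rightarrow> real ^ 'd ^ 'd \<Rightarrow> real \<Rightarrow>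
   (real ^ 'd \<Rightarrow> complex ^ 'n) \<Rightarrow> real ^ 'd \<Rightarrow> complex ^ 'n"
  where "OU_semigroup A B S t v x =
    (if t > 0 then (\<integral>\<xi>. OU_kernel A B S x \<xi> t *v v \<xi> \<partial>lebesgue) else v x)"

end

(* Diagonalising A and B simultaneously by Y turns the kernel into scalar heat kernels
   c_k(t) exp (- b_k t - |e^(tS) x - xi|^2 / (4 t l_k)) with Re l_k > 0. Their convolution law follows by
   completing the square, which shifts the argument by a real vector only, together with the Gaussian
   integral with complex exponent; the latter is the analytic continuation of the real one to the right
   half-plane, so that all principal powers match. The rotations e^(tS) are isometric because S is
   skew-symmetric, which lets them pass through the Gaussians.

   For boundedness, the kernel is dominated by a real Gaussian in e^(tS) x - xi. Radiality gives
   theta(x) = theta(e^(tS) x), and the growth condition on theta is absorbed into the Gaussian by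
   halving its exponent; Schur's test then applies with exactly equal row and column integrals. *)

theory Submission
  imports Defs "HOL-Probability.Distributions" "HOL-Complex_Analysis.Conformal_Mappings"
begin

section \<open>Gaussian integrals\<close>

text \<open>Principal powers are not multiplicative on the complex plane, so the prefactors of two
  kernels cannot simply be combined. They match because only positive real factors are ever pulled
  out of a power, and because the Gaussian integral is itself known as a principal power on the
  whole half-plane. The flow of \<open>S\<close> is handled through its differential equation: a
  solution of \<open>u' = S u\<close> keeps its norm, which gives the isometry and, for the
  difference of two solutions, the group law. Elements of the space are merely Lebesgue measurable,
  whereas Fubini and Tonelli are applied over \<open>lborel \<Otimes>\<^sub>M lborel\<close>. Each
  \<open>v\<close> is therefore replaced by a Borel function equal to it almost everywhere. For
  \<open>t > 0\<close> the operator does not see the difference at any point, so the law holds at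
  every \<open>x\<close>. Exchanging the two integrations in the law calls for its own dominating
  function, since both kernels involve the intermediate point; it is built as a product of one
  function of each variable.\<close>

lemma nn_integral_gaussian:
  assumes "a > 0"
  shows "(\<integral>\<^sup>+z. ennreal (exp (- a * (norm (z::'a::euclidean_space))\<^sup>2)) \<partial>lborel) =
    ennreal (sqrt (pi / a) ^ DIM('a))"
proof -
  \<comment> \<open>The variance \<open>1 / (2 * a)\<close> makes the one-dimensional Gaussian a
    multiple of the normal density, whose total mass is known.\<close>
  define \<sigma> where "\<sigma> = sqrt (1 / (2 * a))"
  have \<sigma>: "\<sigma> > 0" "\<sigma>\<^sup>2 = 1 / (2 * a)" using assms by (auto simp: \<sigma>_def)
  have eq: "exp (- a * x\<^sup>2) = sqrt (pi / a) * normal_density 0 \<sigma> x" for x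
    using assms unfolding normal_density_def \<sigma>(2) by (simp add: field_simps real_sqrt_divide)
  have one: "(\<integral>\<^sup>+x. ennreal (exp (- a * x\<^sup>2)) \<partial>lborel) = ennreal (sqrt (pi / a))"
  proof (subst nn_integral_eq_integral)
    show "integrable lborel (\<lambda>x. exp (- a * x\<^sup>2))" unfolding eq using \<sigma> by simp
    show "ennreal (LBINT x. exp (- a * x\<^sup>2)) = ennreal (sqrt (pi / a))" unfolding eq using \<sigma> by simp
  qed auto
  have "(norm z)\<^sup>2 = (\<Sum>b\<in>Basis. (z \<bullet> b)\<^sup>2)" for z :: 'a
    unfolding power2_norm_eq_inner by (subst euclidean_inner) (simp add: power2_eq_square)
  then have "exp (- a * (norm z)\<^sup>2) = (\<Prod>b\<in>Basis. exp (- a * (z \<bullet> b)\<^sup>2))" for z :: 'a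
    by (simp add: exp_sum[symmetric] sum_distrib_left sum_negf)
  then have "(\<integral>\<^sup>+z. ennreal (exp (- a * (norm (z::'a))\<^sup>2)) \<partial>lborel) =
     (\<integral>\<^sup>+z. (\<Prod>b\<in>Basis. ennreal (exp (- a * ((z::'a) \<bullet> b)\<^sup>2))) \<partial>lborel)"
    by (simp add: prod_ennreal)
  also have "\<dots> = (\<Prod>b\<in>(Basis::'a set). (\<integral>\<^sup>+x. ennreal (exp (- a * x\<^sup>2)) \<partial>lborel))"
    by (rule nn_integral_lborel_prod) auto
  also have "\<dots> = ennreal (sqrt (pi / a) ^ DIM('a))"
    unfolding one using assms by (simp add: ennreal_power)
  finally show ?thesis .
qed

lemma integrable_gaussian:
  assumes "a > 0"
  shows "integrable lborel (\<lambda>z::'a::euclidean_space. exp (- a * (norm z)\<^sup>2))"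
  using nn_integral_gaussian[OF assms, where 'a='a] by (intro integrableI_bounded) auto

lemma integral_gaussian:
  assumes "a > 0"
  shows "(\<integral>z. exp (- a * (norm (z::'a::euclidean_space))\<^sup>2) \<partial>lborel) = sqrt (pi / a) ^ DIM('a)"
  using nn_integral_gaussian[OF assms, where 'a='a] assms
  by (subst integral_eq_nn_integral) auto

lemma integrable_complex_gaussian:
  assumes "Re c > 0"
  shows "integrable lborel (\<lambda>z::'a::euclidean_space. exp (- c * of_real ((norm z)\<^sup>2)))"
  by (rule Bochner_Integration.integrable_bound[OF integrable_gaussian[OF assms]])
     (auto simp: norm_exp_eq_Re)

text \<open>Differentiation under the integral sign is carried out on the compact boxes
  \<open>?B n\<close>. The truncated integrals converge locally uniformly in \<open>c\<close>,
  because their tails are controlled by a real Gaussian that is the same for all \<open>c\<close>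
  near \<open>c0\<close>.\<close>

lemma complex_gaussian_holomorphic:
  "(\<lambda>c. \<integral>z. exp (- c * of_real ((norm (z::'a::euclidean_space))\<^sup>2)) \<partial>lborel) holomorphic_on {c. Re c > 0}"
proof (rule holomorphic_uniform_sequence)
  let ?e = "\<lambda>c z::'a. exp (- c * of_real ((norm z)\<^sup>2)) :: complex"
  let ?B = "\<lambda>n. cbox (- (of_nat n *\<^sub>R One)) (of_nat n *\<^sub>R One :: 'a)"
  show "open {c::complex. Re c > 0}" by (rule open_halfspace_Re_gt)
  show "(\<lambda>c. integral (?B n) (?e c)) holomorphic_on {c. Re c > 0}" for n
  proof (rule leibniz_rule_holomorphic[where fx = "\<lambda>c z. ?e c z * - of_real ((norm z)\<^sup>2)"])
    show "((\<lambda>x. ?e x t) has_field_derivative ?e x t * - complex_of_real ((norm t)\<^sup>2)) (at x within {c. 0 < Re c})" for x t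
      by (auto intro!: derivative_eq_intros)
    show "?e x integrable_on ?B n" for x
      by (intro integrable_continuous continuous_intros)
    show "continuous_on ({c. 0 < Re c} \<times> ?B n) (\<lambda>(x, t). ?e x t * - complex_of_real ((norm t)\<^sup>2))"
      unfolding split_beta by (intro continuous_intros)
    show "convex {c. 0 < Re c}" by (rule convex_halfspace_Re_gt)
  qed
  fix c0 :: complex assume "c0 \<in> {c. Re c > 0}"
  \<comment> \<open>Half of \<open>Re c0\<close>: the disc of this radius stays inside
    \<open>Re c \<ge> r\<close>, so \<open>r\<close> is a common decay rate on it.\<close>
  define r where "r = Re c0 / 2"
  have r: "r > 0" using \<open>c0 \<in> _\<close> by (simp add: r_def)
  have Re: "Re c \<ge> r" if "c \<in> cball c0 r" for c
  proof -
    have "\<bar>Re (c0 - c)\<bar> \<le> r" using abs_Re_le_cmod[of "c0 - c"] that by (simp add: dist_norm)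
    then have "Re c0 - Re c \<le> r" by simp
    then show ?thesis by (simp add: r_def)
  qed
  have "(\<lambda>n. \<integral>z. indicator (- ?B n) z * exp (- r * (norm z)\<^sup>2) \<partial>lborel) \<longlonglongrightarrow> (\<integral>z. 0 \<partial>(lborel :: 'a measure))"
  proof (rule integral_dominated_convergence)
    show "integrable lborel (\<lambda>z::'a. exp (- r * (norm z)\<^sup>2))" using r by (rule integrable_gaussian)
    \<comment> \<open>Each point lies in all boxes from some index on, so the tail integrand is
      eventually zero there.\<close>
    have "eventually (\<lambda>n. indicator (- ?B n) z * exp (- r * (norm z)\<^sup>2) = 0) sequentially" for z :: 'a
    proof -
      obtain N where N: "norm z \<le> of_nat N" using real_arch_simple by blast
      have "z \<in> ?B n" if "n \<ge> N" for n
      proof -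
        have "\<bar>z \<bullet> b\<bar> \<le> real n" if "b \<in> Basis" for b
          using Basis_le_norm[OF that, of z] N \<open>n \<ge> N\<close> by linarith
        then show ?thesis by (force simp: mem_box)
      qed
      then show ?thesis by (auto simp: eventually_sequentially indicator_def intro!: exI[of _ N])
    qed
    then show "AE z::'a in lborel. (\<lambda>n. indicator (- ?B n) z * exp (- r * (norm z)\<^sup>2)) \<longlonglongrightarrow> 0"
      by (auto intro: tendsto_eventually)
  qed (auto simp: indicator_def)
  then have lim: "(\<lambda>n. \<integral>z. indicator (- ?B n) z * exp (- r * (norm (z::'a))\<^sup>2) \<partial>lborel) \<longlonglongrightarrow> 0" by simp
  have bound: "norm (integral (?B n) (?e c) - (\<integral>z. ?e c z \<partial>lborel)) \<le>
     (\<integral>z. indicator (- ?B n) z * exp (- r * (norm (z::'a))\<^sup>2) \<partial>lborel)" if "c \<in> cball c0 r" for n c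
  proof -
    have c: "Re c > 0" using Re[OF that] r by simp
    have ic: "integrable lborel (?e c)" by (rule integrable_complex_gaussian[OF c])
    have iB: "integrable lborel (\<lambda>z. indicator (?B n) z *\<^sub>R ?e c z)"
      using ic by (rule integrable_mult_indicator[rotated]) auto
    have sB: "set_integrable lborel (?B n) (?e c)" using iB by (simp add: set_integrable_def)
    have "integral (?B n) (?e c) = (\<integral>z. indicator (?B n) z *\<^sub>R ?e c z \<partial>lborel)"
      using set_borel_integral_eq_integral(2)[OF sB] by (simp add: set_lebesgue_integral_def)
    then have "integral (?B n) (?e c) - (\<integral>z. ?e c z \<partial>lborel) = 
        (\<integral>z. indicator (?B n) z *\<^sub>R ?e c z - ?e c z \<partial>lborel)"
      using ic iB by simp
    also have "norm \<dots> \<le> (\<integral>z. norm (indicator (?B n) z *\<^sub>R ?e c z - ?e c z) \<partial>lborel)"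
      by (rule integral_norm_bound)
    also have "\<dots> \<le> (\<integral>z. indicator (- ?B n) z * exp (- r * (norm (z::'a))\<^sup>2) \<partial>lborel)"
    proof (rule integral_mono)
      show "integrable lborel (\<lambda>z. norm (indicator (?B n) z *\<^sub>R ?e c z - ?e c z))"
        using ic iB by auto
      show "integrable lborel (\<lambda>z::'a. indicator (- ?B n) z * exp (- r * (norm z)\<^sup>2))"
        using integrable_mult_indicator[OF _ integrable_gaussian[OF r], of "- ?B n"] by simp
      show "norm (indicator (?B n) z *\<^sub>R ?e c z - ?e c z) \<le> indicator (- ?B n) z * exp (- r * (norm z)\<^sup>2)" for z
        using mult_right_mono[OF Re[OF that], of "(norm z)\<^sup>2"]
        by (auto simp: indicator_def norm_exp_eq_Re)
    qed
    finally show ?thesis .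
  qed
  have "uniform_limit (cball c0 r) (\<lambda>n c. integral (?B n) (?e c)) (\<lambda>c. \<integral>z. ?e c z \<partial>lborel) sequentially"
  proof (rule uniform_limitI)
    fix e :: real assume "e > 0"
    then have "\<forall>\<^sub>F n in sequentially. (\<integral>z. indicator (- ?B n) z * exp (- r * (norm (z::'a))\<^sup>2) \<partial>lborel) < e"
      using lim by (auto dest: order_tendstoD)
    then show "\<forall>\<^sub>F n in sequentially. \<forall>c\<in>cball c0 r. dist (integral (?B n) (?e c)) (\<integral>z. ?e c z \<partial>lborel) < e"
      by eventually_elim (auto simp only: dist_norm intro: le_less_trans[OF bound])
  qed
  then show "\<exists>d>0. cball c0 d \<subseteq> {c. 0 < Re c} \<and>
      uniform_limit (cball c0 d) (\<lambda>n c. integral (?B n) (?e c)) (\<lambda>c. \<integral>z. ?e c z \<partial>lborel) sequentially"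
    using r Re by (intro exI[of _ r]) force
qed

text \<open>Both sides are holomorphic on the right half-plane, where \<open>c / of_real pi\<close>
  avoids the branch cut, and they agree on the positive reals, which accumulate at 1. Continuation
  also settles which branch of the root occurs.\<close>

lemma complex_gaussian_integral:
  assumes "Re c > 0"
  shows "(\<integral>z. exp (- c * of_real ((norm (z::'a::euclidean_space))\<^sup>2)) \<partial>lborel) =
    (c / of_real pi) powr (- of_nat DIM('a) / 2)" (is "?F c = ?G c")
proof -
  have "?F c - ?G c = 0"
  proof (rule analytic_continuation[of "\<lambda>c. ?F c - ?G c" "{c. Re c > 0}" "of_real ` {0<..}" 1])
    have "(\<lambda>c. ?G c) holomorphic_on {c. Re c > 0}"
      by (intro holomorphic_intros) (use pi_gt_zero in \<open>auto simp: complex_nonpos_Reals_iff divide_le_0_iff simp del: pi_gt_zero\<close>)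
    then show "(\<lambda>c. ?F c - ?G c) holomorphic_on {c. Re c > 0}"
      by (intro holomorphic_on_diff complex_gaussian_holomorphic)
    show "open {c::complex. Re c > 0}" by (rule open_halfspace_Re_gt)
    show "connected {c::complex. Re c > 0}" by (intro convex_connected convex_halfspace_Re_gt)
    show "1 islimpt (complex_of_real ` {0<..})"
    proof -
      have "(\<lambda>n. complex_of_real (1 + inverse (real (Suc n)))) \<longlonglongrightarrow> of_real (1 + 0)"
        by (intro tendsto_intros LIMSEQ_inverse_real_of_nat)
      moreover have "complex_of_real (1 + inverse (real (Suc n))) \<in> of_real ` {0<..} - {1}" for n
      proof -
        have "1 + inverse (real (Suc n)) > 0" "1 + inverse (real (Suc n)) \<noteq> 1"
          by (simp_all add: add_pos_pos)
        then show ?thesis by (metis DiffI greaterThan_iff imageI of_real_eq_1_iff singletonD)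
      qed
      ultimately show ?thesis
        unfolding islimpt_sequential
        by (intro exI[of _ "\<lambda>n. complex_of_real (1 + inverse (real (Suc n)))"]) (simp only: add_0_right of_real_1 simp_thms)
    qed
    fix x assume "x \<in> complex_of_real ` {0<..}"
    then obtain a where a: "a > 0" "x = of_real a" by auto
    have "?F x = of_real (\<integral>z. exp (- a * (norm (z::'a))\<^sup>2) \<partial>lborel)"
      unfolding a(2) by (simp flip: integral_complex_of_real exp_of_real of_real_mult of_real_minus of_real_power)
    also have "\<dots> = of_real (sqrt (pi / a) ^ DIM('a))" by (simp only: integral_gaussian[OF a(1)])
    also have "sqrt (pi / a) ^ DIM('a) = (a / pi) powr (- real DIM('a) / 2)"
    proof -
      have "sqrt (pi / a) ^ DIM('a) = ((pi / a) powr (1/2)) powr real DIM('a)"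
        using a by (simp add: powr_realpow powr_half_sqrt)
      also have "\<dots> = inverse (a / pi) powr (real DIM('a) / 2)"
        by (simp add: powr_powr)
      also have "\<dots> = (a / pi) powr (- real DIM('a) / 2)" using a by (simp add: powr_minus powr_divide)
      finally show ?thesis .
    qed
    also have "complex_of_real \<dots> = ?G x"
      using a by (subst powr_of_real[symmetric]) auto
    finally show "?F x - ?G x = 0" by simp
  qed (use assms in auto)
  then show ?thesis by simp
qed

section \<open>Exponentials of matrices\<close>

abbreviation matrix_power :: "'a::semiring_1 ^ 'n ^ 'n \<Rightarrow> nat \<Rightarrow> 'a ^ 'n ^ 'n"
  where "matrix_power M k \<equiv> ((**) M ^^ k) (mat 1)"

section \<open>The matrix exponential as a power series in time, and skew-symmetric flows\<close>

lemma sums_vec: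
  assumes "\<And>i. (\<lambda>k. f k $ i) sums (g $ i)"
  shows "f sums (g :: 'a::real_normed_vector ^ 'n)"
  using assms unfolding sums_def by (intro vec_tendstoI) (simp add: sum_component)

lemma matrix_power_scaleR:
  fixes S :: "real ^ 'd ^ 'd"
  shows "matrix_power (t *\<^sub>R S) k = t ^ k *\<^sub>R matrix_power S k"
  by (induction k) (simp_all add: scalar_matrix_assoc matrix_scalar_ac mult.commute)

lemma norm_matrix_power_le:
  fixes S :: "real ^ 'd ^ 'd"
  shows "norm (matrix_power S k *v x) \<le> onorm ((*v) S) ^ k * norm x"
proof (induction k)
  case (Suc k)
  have "norm (S *v (matrix_power S k *v x)) \<le> onorm ((*v) S) * norm (matrix_power S k *v x)"
    by (rule onorm) (simp add: matrix_vector_mul_bounded_linear)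
  also have "\<dots> \<le> onorm ((*v) S) * (onorm ((*v) S) ^ k * norm x)"
    by (intro mult_left_mono Suc onorm_pos_le) (simp add: matrix_vector_mul_bounded_linear)
  finally show ?case by (simp add: matrix_vector_mul_assoc)
qed simp

text \<open>The terms are written as a power series in \<open>t\<close> with coefficients free of
  \<open>t\<close>, the form that termwise differentiation requires. The majorant is the exponential
  series of the operator norm of \<open>S\<close> times \<open>\<bar>t\<bar>\<close>.\<close>

lemma summable_matrix_exp_entry:
  fixes S :: "real ^ 'd ^ 'd"
  shows "summable (\<lambda>k. (matrix_power S k *v x) $ i / fact k * t ^ k)"
proof (rule summable_comparison_test')
  show "summable (\<lambda>k. norm x * ((onorm ((*v) S) * \<bar>t\<bar>) ^ k /\<^sub>R fact k))"
    by (intro summable_mult summable_exp_generic)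
  show "norm ((matrix_power S k *v x) $ i / fact k * t ^ k) \<le> norm x * ((onorm ((*v) S) * \<bar>t\<bar>) ^ k /\<^sub>R fact k)" for k
    using mult_right_mono[OF order_trans[OF component_le_norm_cart[of _ i] norm_matrix_power_le[of k S x]], of "\<bar>t\<bar> ^ k / fact k"]
    by (simp add: abs_mult power_abs power_mult_distrib field_simps)
qed

lemma matrix_exp_entry:
  fixes S :: "real ^ 'd ^ 'd"
  shows "matrix_exp (t *\<^sub>R S) $ i $ j = (\<Sum>k. matrix_power S k $ i $ j / fact k * t ^ k)"
proof -
  have *: "(\<lambda>k. matrix_power S k $ i $ j / fact k * t ^ k) sums (\<Sum>k. matrix_power S k $ i $ j / fact k * t ^ k)" for i j
    \<comment> \<open>Applied to the unit vector \<open>axis j 1\<close>, a power of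
      \<open>S\<close> returns its column \<open>j\<close>, so entries are a case of the vector
      statement.\<close>
    using summable_matrix_exp_entry[of S "axis j 1" i t]
    by (intro summable_sums) (simp add: matrix_vector_mul_component inner_axis)
  have "(\<lambda>k. matrix_power (t *\<^sub>R S) k /\<^sub>R fact k) sums (\<chi> i j. \<Sum>k. matrix_power S k $ i $ j / fact k * t ^ k)"
    using * by (intro sums_vec) (simp add: matrix_power_scaleR field_simps)
  then show ?thesis unfolding matrix_exp_def by (simp add: sums_iff)
qed

lemma matrix_exp_vector_entry:
  fixes S :: "real ^ 'd ^ 'd"
  shows "(matrix_exp (t *\<^sub>R S) *v x) $ i = (\<Sum>k. (matrix_power S k *v x) $ i / fact k * t ^ k)"
proof -
  have s: "summable (\<lambda>k. matrix_power S k $ i $ j / fact k * t ^ k)" for j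
    using summable_matrix_exp_entry[of S "axis j 1" i t]
    by (simp add: matrix_vector_mul_component inner_axis)
  have "(matrix_exp (t *\<^sub>R S) *v x) $ i = (\<Sum>j\<in>UNIV. (\<Sum>k. matrix_power S k $ i $ j / fact k * t ^ k * x $ j))"
    unfolding suminf_mult2[OF s, symmetric] by (simp add: matrix_vector_mult_def matrix_exp_entry)
  also have "\<dots> = (\<Sum>k. \<Sum>j\<in>UNIV. matrix_power S k $ i $ j / fact k * t ^ k * x $ j)"
    by (rule suminf_sum[symmetric]) (intro summable_mult2 s)
  also have "\<dots> = (\<Sum>k. (matrix_power S k *v x) $ i / fact k * t ^ k)"
    by (intro suminf_cong) (simp add: matrix_vector_mult_def sum_distrib_right sum_distrib_left sum_divide_distrib mult_ac)
  finally show ?thesis .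
qed

lemma has_derivative_matrix_exp_vector:
  fixes S :: "real ^ 'd ^ 'd"
  shows "((\<lambda>t. (matrix_exp (t *\<^sub>R S) *v x) $ i) has_real_derivative
    (S *v (matrix_exp (t *\<^sub>R S) *v x)) $ i) (at t)"
proof -
  have "((\<lambda>t. (matrix_exp (t *\<^sub>R S) *v x) $ i) has_real_derivative
     (\<Sum>k. diffs (\<lambda>k. (matrix_power S k *v x) $ i / fact k) k * t ^ k)) (at t)"
    unfolding matrix_exp_vector_entry
    by (rule termdiffs_strong_converges_everywhere) (rule summable_matrix_exp_entry)
  also have "(\<Sum>k. diffs (\<lambda>k. (matrix_power S k *v x) $ i / fact k) k * t ^ k) =
      (\<Sum>k. \<Sum>j\<in>UNIV. S $ i $ j * ((matrix_power S k *v x) $ j / fact k * t ^ k))"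
  proof (rule suminf_cong)
    fix k
    have "diffs (\<lambda>k. (matrix_power S k *v x) $ i / fact k) k = (S *v (matrix_power S k *v x)) $ i / fact k"
      by (simp add: diffs_def matrix_vector_mul_assoc del: of_nat_Suc)
    then show "diffs (\<lambda>k. (matrix_power S k *v x) $ i / fact k) k * t ^ k =
       (\<Sum>j\<in>UNIV. S $ i $ j * ((matrix_power S k *v x) $ j / fact k * t ^ k))"
      by (simp add: matrix_vector_mult_def[of S] sum_distrib_right sum_divide_distrib mult.assoc)
  qed
  also have "\<dots> = (\<Sum>j\<in>UNIV. \<Sum>k. S $ i $ j * ((matrix_power S k *v x) $ j / fact k * t ^ k))"
    by (rule suminf_sum) (intro summable_mult summable_matrix_exp_entry)
  also have "\<dots> = (S *v (matrix_exp (t *\<^sub>R S) *v x)) $ i"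
    by (simp only: matrix_vector_mult_def[of S] matrix_exp_vector_entry vec_lambda_beta suminf_mult[OF summable_matrix_exp_entry])
  finally show ?thesis .
qed

text \<open>The squared norm has derivative twice \<open>u \<bullet> (S *v u)\<close>, which
  vanishes for skew-symmetric \<open>S\<close>. Stating this for an arbitrary solution lets it serve
  as a uniqueness result too, by taking \<open>u\<close> to be a difference of solutions.\<close>

lemma norm_constant_skew_flow:
  fixes S :: "real ^ 'd ^ 'd"
  assumes skew: "transpose S = - S"
    and u: "\<And>t i. ((\<lambda>t. u t $ i) has_real_derivative (S *v u t) $ i) (at t)"
  shows "norm (u t) = norm (u 0)"
proof -
  have "((\<lambda>t. \<Sum>i\<in>UNIV. (u t $ i)\<^sup>2) has_real_derivative 0) (at t)" for t
  proof -
    have "((\<lambda>t. \<Sum>i\<in>UNIV. (u t $ i)\<^sup>2) has_real_derivative (\<Sum>i\<in>UNIV. 2 * (u t $ i * (S *v u t) $ i))) (at t)"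
      by (rule DERIV_sum) (auto intro!: derivative_eq_intros u)
    also have "(\<Sum>i\<in>UNIV. 2 * (u t $ i * (S *v u t) $ i)) = 2 * (u t \<bullet> (S *v u t))"
      by (simp add: inner_vec_def sum_distrib_left)
    \<comment> \<open>Moving \<open>S\<close> to the other factor of the inner product reverses the
      sign, so the quantity equals its own negative.\<close>
    also have "u t \<bullet> (S *v u t) = - (u t \<bullet> (S *v u t))"
    proof -
      have "u t \<bullet> (S *v u t) = (transpose S *v u t) \<bullet> u t"
        by (simp add: dot_lmul_matrix[symmetric] inner_commute)
      also have "\<dots> = - (u t \<bullet> (S *v u t))"
        using matrix_vector_mult_diff_rdistrib[of 0 S "u t"] by (simp add: skew inner_commute)
      finally show ?thesis .
    qed
    then have "u t \<bullet> (S *v u t) = 0" by simp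
    finally show ?thesis by simp
  qed
  then have "(\<Sum>i\<in>UNIV. (u t $ i)\<^sup>2) = (\<Sum>i\<in>UNIV. (u 0 $ i)\<^sup>2)"
    by (metis DERIV_isconst_all)
  then show ?thesis by (simp add: norm_vec_def L2_set_def)
qed

lemma matrix_exp_zero: "matrix_exp (0 *\<^sub>R S) *v x = (x :: real ^ 'd)"
  by (simp only: vec_eq_iff matrix_exp_vector_entry powser_zero) simp

lemma norm_matrix_exp_skew:
  fixes S :: "real ^ 'd ^ 'd"
  assumes "transpose S = - S"
  shows "norm (matrix_exp (t *\<^sub>R S) *v x) = norm x"
  using norm_constant_skew_flow[OF assms has_derivative_matrix_exp_vector, of t x]
  by (simp only: matrix_exp_zero)

text \<open>As functions of \<open>t\<close>, both sides solve the same linear equation and agree at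
  \<open>t = 0\<close>. Their difference has constant norm, hence is zero.\<close>

lemma matrix_exp_skew_add:
  fixes S :: "real ^ 'd ^ 'd"
  assumes "transpose S = - S"
  shows "matrix_exp ((t + s) *\<^sub>R S) *v x = matrix_exp (t *\<^sub>R S) *v (matrix_exp (s *\<^sub>R S) *v x)"
proof -
  let ?E = "\<lambda>t. matrix_exp (t *\<^sub>R S)"
  have "norm (?E (t + s) *v x - ?E t *v (?E s *v x)) = norm (?E (0 + s) *v x - ?E 0 *v (?E s *v x))"
  proof (rule norm_constant_skew_flow[OF assms])
    fix t i
    have "((\<lambda>t. (?E (t + s) *v x) $ i) has_real_derivative (S *v (?E (t + s) *v x)) $ i) (at t)"
      using has_derivative_matrix_exp_vector[of S x i "t + s"] by (simp add: DERIV_shift)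
    then show "((\<lambda>t. (?E (t + s) *v x - ?E t *v (?E s *v x)) $ i) has_real_derivative
        (S *v (?E (t + s) *v x - ?E t *v (?E s *v x))) $ i) (at t)"
      unfolding matrix_vector_mult_diff_distrib vector_minus_component
      by (intro DERIV_diff has_derivative_matrix_exp_vector)
  qed
  then show ?thesis unfolding matrix_exp_zero by simp
qed

text \<open>Transfers the rotation from one variable to the other, so that the kernel becomes an
  unrotated Gaussian in whichever variable is being integrated.\<close>

lemma norm_matrix_exp_skew_diff:
  fixes S :: "real ^ 'd ^ 'd"
  assumes "transpose S = - S"
  shows "norm (matrix_exp (t *\<^sub>R S) *v x - y) = norm (x - matrix_exp (- t *\<^sub>R S) *v y)"
proof -
  let ?E = "\<lambda>t. matrix_exp (t *\<^sub>R S)"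
  have "y = ?E t *v (?E (- t) *v y)"
    using matrix_exp_skew_add[OF assms, of t "-t" y] by (simp only: add.right_inverse matrix_exp_zero)
  then have "norm (?E t *v x - y) = norm (?E t *v (x - ?E (- t) *v y))"
    by (simp only: matrix_vector_mult_diff_distrib)
  then show ?thesis by (simp only: norm_matrix_exp_skew[OF assms])
qed

section \<open>Calculus of matrices diagonalised by a fixed invertible \<open>Y\<close>\<close>

lemma invertible_matrix_inv:
  fixes Y :: "'a::semiring_1 ^ 'n ^ 'm"
  assumes "invertible Y"
  shows "Y ** matrix_inv Y = mat 1" "matrix_inv Y ** Y = mat 1"
  using someI_ex[OF assms[unfolded invertible_def]] by (simp_all add: matrix_inv_def)

lemma matrix_inv_eqI:
  fixes M :: "'a::semiring_1 ^ 'n ^ 'n"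
  assumes "M ** N = mat 1" "N ** M = mat 1"
  shows "matrix_inv M = N"
proof -
  have "invertible M" using assms by (auto simp: invertible_def)
  from invertible_matrix_inv[OF this] assms show ?thesis
    by (metis matrix_mul_assoc matrix_mul_lid matrix_mul_rid)
qed

lemma diag_matrix_vector: "(diag_matrix l *v z) $ i = l i * (z :: 'a::comm_semiring_1 ^ 'n) $ i"
proof -
  have "(\<Sum>j\<in>UNIV. (if i = j then l i else 0) * z $ j) = (\<Sum>j\<in>UNIV. if i = j then l i * z $ j else 0)"
    by (rule sum.cong) auto
  then show ?thesis by (simp add: diag_matrix_def matrix_vector_mult_def)
qed

lemma diag_matrix_mult: "diag_matrix l ** diag_matrix m = (diag_matrix (\<lambda>k. l k * m k) :: 'a::comm_semiring_1 ^ 'n ^ 'n)"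
  by (simp add: vec_eq_iff diag_matrix_mult_left) (simp add: diag_matrix_def)

lemma diag_matrix_one: "diag_matrix (\<lambda>_. 1) = mat 1"
  by (simp add: diag_matrix_def mat_def)

lemma conj_diag_mult:
  fixes Y :: "'a::comm_semiring_1 ^ 'n ^ 'n"
  assumes "invertible Y"
  shows "(Y ** diag_matrix l ** matrix_inv Y) ** (Y ** diag_matrix m ** matrix_inv Y) =
    Y ** diag_matrix (\<lambda>k. l k * m k) ** matrix_inv Y"
proof -
  have "matrix_inv Y ** (Y ** X) = X" for X :: "'a ^ 'n ^ 'n"
    using invertible_matrix_inv[OF assms] by (simp add: matrix_mul_assoc)
  then show ?thesis
    by (simp only: diag_matrix_mult[symmetric] matrix_mul_assoc[symmetric])
qed

lemma conj_diag_one: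
  fixes Y :: "'a::comm_semiring_1 ^ 'n ^ 'n"
  assumes "invertible Y"
  shows "Y ** diag_matrix (\<lambda>k. 1) ** matrix_inv Y = mat 1"
  using invertible_matrix_inv[OF assms] by (simp add: diag_matrix_one)

lemma conj_diag_entry:
  fixes Y Z :: "'a::comm_semiring_1 ^ 'n ^ 'n"
  shows "(Y ** diag_matrix l ** Z) $ i $ j = (\<Sum>k\<in>UNIV. Y $ i $ k * l k * Z $ k $ j)"
  by (simp add: matrix_matrix_mult_def[of "Y ** diag_matrix l"] diag_matrix_mult_right)

lemma conj_diag_scaleR:
  fixes Y Z :: "complex ^ 'n ^ 'n"
  shows "r *\<^sub>R (Y ** diag_matrix l ** Z) = Y ** diag_matrix (\<lambda>k. of_real r * l k) ** Z"
  by (simp add: vec_eq_iff conj_diag_entry scaleR_sum_right) (simp add: scaleR_conv_of_real mult_ac)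

lemma conj_diag_uminus:
  fixes Y Z :: "complex ^ 'n ^ 'n"
  shows "- (Y ** diag_matrix l ** Z) = Y ** diag_matrix (\<lambda>k. - l k) ** Z"
  by (simp add: vec_eq_iff conj_diag_entry sum_negf)

lemma conj_diag_diff:
  fixes Y Z :: "complex ^ 'n ^ 'n"
  shows "Y ** diag_matrix l ** Z - Y ** diag_matrix m ** Z = Y ** diag_matrix (\<lambda>k. l k - m k) ** Z"
  by (simp add: vec_eq_iff conj_diag_entry algebra_simps sum_subtractf)

lemma matrix_inv_conj_diag:
  fixes Y :: "complex ^ 'n ^ 'n"
  assumes "invertible Y" "\<And>k. l k \<noteq> 0"
  shows "matrix_inv (Y ** diag_matrix l ** matrix_inv Y) = Y ** diag_matrix (\<lambda>k. inverse (l k)) ** matrix_inv Y"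
  by (rule matrix_inv_eqI) (simp_all add: conj_diag_mult assms conj_diag_one)

text \<open>Powers act on the diagonal alone, and each entry of the conjugated matrix is a finite
  linear combination of diagonal entries. The matrix series thus splits into scalar exponential
  series.\<close>

lemma matrix_exp_conj_diag:
  fixes Y :: "complex ^ 'n ^ 'n"
  assumes "invertible Y"
  shows "matrix_exp (Y ** diag_matrix l ** matrix_inv Y) = Y ** diag_matrix (\<lambda>k. exp (l k)) ** matrix_inv Y"
proof -
  have "matrix_power (Y ** diag_matrix l ** matrix_inv Y) n = Y ** diag_matrix (\<lambda>k. l k ^ n) ** matrix_inv Y" for n
    by (induction n) (simp_all add: conj_diag_one[OF assms] conj_diag_mult[OF assms])
  moreover have "(\<lambda>n. Y ** diag_matrix (\<lambda>k. l k ^ n /\<^sub>R fact n) ** matrix_inv Y) sums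
      (Y ** diag_matrix (\<lambda>k. exp (l k)) ** matrix_inv Y)"
    unfolding conj_diag_entry by (intro sums_vec) (simp only: conj_diag_entry, intro sums_sum sums_mult2 sums_mult exp_converges)
  ultimately show ?thesis
    unfolding matrix_exp_def by (simp only: conj_diag_scaleR scaleR_conv_of_real[where 'a=complex] sums_iff)
qed

text \<open>The diagonal entry of the kernel belonging to the eigenvalues \<open>a\<close> of
  \<open>A\<close> and \<open>b\<close> of \<open>B\<close>. It takes the squared distance
  \<open>r\<close> instead of two points, so that isometries can be applied inside the
  argument.\<close>

definition heat_coeff :: "nat \<Rightarrow> complex \<Rightarrow> complex \<Rightarrow> real \<Rightarrow> real \<Rightarrow> complex"
  where "heat_coeff d a b t r =
    (of_real (4 * pi * t) * a) powr (- of_nat d / 2) * exp (- of_real t * b - of_real r * inverse (of_real (4 * t) * a))"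

lemma OU_kernel_conj_diag:
  fixes Y :: "complex ^ 'n ^ 'n" and S :: "real ^ 'd ^ 'd"
  assumes "invertible Y" "\<And>k. l k \<noteq> 0" "t > 0"
  shows "OU_kernel (Y ** diag_matrix l ** matrix_inv Y) (Y ** diag_matrix m ** matrix_inv Y) S x \<xi> t =
    Y ** diag_matrix (\<lambda>k. heat_coeff CARD('d) (l k) (m k) t ((norm (matrix_exp (t *\<^sub>R S) *v x - \<xi>))\<^sup>2)) ** matrix_inv Y"
proof -
  let ?C = "\<lambda>l. Y ** diag_matrix l ** matrix_inv Y"
  let ?r = "(norm (matrix_exp (t *\<^sub>R S) *v x - \<xi>))\<^sup>2"
  have "matrix_inv ((4 * t) *\<^sub>R ?C l) = ?C (\<lambda>k. inverse (of_real (4 * t) * l k))"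
    unfolding conj_diag_scaleR using assms by (intro matrix_inv_conj_diag) auto
  then have "matrix_exp (- (t *\<^sub>R ?C m) - ?r *\<^sub>R matrix_inv ((4 * t) *\<^sub>R ?C l)) =
     ?C (\<lambda>k. exp (- (of_real t * m k) - of_real ?r * inverse (of_real (4 * t) * l k)))"
    by (simp only: conj_diag_uminus conj_diag_scaleR conj_diag_diff matrix_exp_conj_diag[OF assms(1)])
  then show ?thesis
    unfolding OU_kernel_def heat_coeff_def
    by (simp only: conj_diag_scaleR matrix_cpow_diag[OF assms(1)] conj_diag_mult[OF assms(1)] mult_minus_left)
qed

text \<open>Column \<open>k\<close> of \<open>Y\<close> is an eigenvector. This converts the
  hypothesis on the eigenvalues of \<open>A\<close> into positivity of every
  \<open>Re (l k)\<close>.\<close>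

lemma eigenvalue_conj_diag:
  fixes Y :: "complex ^ 'n ^ 'n"
  assumes "invertible Y"
  shows "eigenvalue (Y ** diag_matrix l ** matrix_inv Y) (l k)"
proof -
  have e: "diag_matrix l *v axis k 1 = l k *s axis k (1::complex)"
    by (simp add: vec_eq_iff diag_matrix_vector axis_def)
  have i: "matrix_inv Y *v (Y *v z) = z" for z
    using invertible_matrix_inv[OF assms] by (simp add: matrix_vector_mul_assoc)
  have "Y *v axis k 1 \<noteq> 0"
    using i[of "axis k 1"] by (metis axis_eq_0_iff matrix_vector_mult_0_right zero_neq_one)
  moreover have "(Y ** diag_matrix l ** matrix_inv Y) *v (Y *v axis k 1) = l k *s (Y *v axis k 1)"
    by (simp add: matrix_vector_mul_assoc[symmetric] i e vector_scalar_commute)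
  ultimately show ?thesis unfolding eigenvalue_def by blast
qed

section \<open>Convolution of heat kernels\<close>

lemma complex_gaussian_integral_shifted:
  assumes "Re c > 0"
  shows "(\<integral>z. exp (- c * of_real ((norm (z - m :: 'a::euclidean_space))\<^sup>2)) \<partial>lborel) =
    (c / of_real pi) powr (- of_nat DIM('a) / 2)"
proof -
  have "(\<integral>z. exp (- c * of_real ((norm (z - m))\<^sup>2)) \<partial>lborel) =
      (\<integral>z. exp (- c * of_real ((norm (z - m))\<^sup>2)) \<partial>distr lborel borel ((+) m))"
    by (simp only: lborel_distr_plus)
  also have "\<dots> = (\<integral>z. exp (- c * of_real ((norm (z::'a))\<^sup>2)) \<partial>lborel)"
    by (subst integral_distr) auto
  finally show ?thesis by (simp only: complex_gaussian_integral[OF assms])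
qed

lemma nn_integral_gaussian_shifted:
  assumes "a > 0"
  shows "(\<integral>\<^sup>+z. ennreal (exp (- a * (norm (z - m :: 'a::euclidean_space))\<^sup>2)) \<partial>lborel) =
    ennreal (sqrt (pi / a) ^ DIM('a))"
proof -
  have "(\<integral>\<^sup>+z. ennreal (exp (- a * (norm (z - m))\<^sup>2)) \<partial>lborel) =
      (\<integral>\<^sup>+z. ennreal (exp (- a * (norm (z - m))\<^sup>2)) \<partial>distr lborel borel ((+) m))"
    by (simp only: lborel_distr_plus)
  also have "\<dots> = (\<integral>\<^sup>+z. ennreal (exp (- a * (norm (z::'a))\<^sup>2)) \<partial>lborel)"
    by (subst nn_integral_distr) auto
  finally show ?thesis by (simp only: nn_integral_gaussian[OF assms])
qed

text \<open>As a function of \<open>\<xi>\<close>, the left side is smallest at the weighted mean of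
  \<open>u\<close> and \<open>y\<close> with weights \<open>s\<close> and \<open>t\<close>, which is
  the centre on the right. Both kernels carry the same complex factor \<open>1 / (4 * a)\<close>, so
  it can stay outside and the identity is purely real.\<close>

lemma gaussian_exponent_square:
  fixes u y \<xi> :: "'a::real_inner"
  assumes "s > 0" "t > 0"
  shows "(norm (u - \<xi>))\<^sup>2 / t + (norm (\<xi> - y))\<^sup>2 / s =
    (norm (u - y))\<^sup>2 / (t + s) + (t + s) / (t * s) * (norm (\<xi> - (y + (s / (t + s)) *\<^sub>R (u - y))))\<^sup>2"
proof -
  \<comment> \<open>With \<open>y\<close> moved to the origin, only the three reals
    \<open>w \<bullet> w\<close>, \<open>w \<bullet> z\<close> and \<open>z \<bullet> z\<close>
    remain, and the claim becomes a rational identity in them.\<close>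
  define z where "z = \<xi> - y"
  define w where "w = u - y"
  have "\<xi> = z + y" "u = w + y" by (simp_all add: z_def w_def)
  then have eq: "u - \<xi> = w - z" "\<xi> - y = z" "u - y = w" by simp_all
  define q where "q = s / (t + s)"
  have eq': "\<xi> - (y + q *\<^sub>R w) = z - q *\<^sub>R w" by (simp add: z_def)
  have "(norm (w - z))\<^sup>2 = w \<bullet> w - 2 * (w \<bullet> z) + z \<bullet> z"
    by (simp add: power2_norm_eq_inner inner_diff inner_commute)
  moreover have "(norm (z - q *\<^sub>R w))\<^sup>2 = z \<bullet> z - 2 * q * (w \<bullet> z) + q\<^sup>2 * (w \<bullet> w)"
    unfolding power2_norm_eq_inner by (simp add: inner_diff inner_commute power2_eq_square)
  moreover have "(W - 2 * P + Z) / t + Z / s = W / (t + s) + (t + s) / (t * s) * (Z - 2 * q * P + q\<^sup>2 * W)" for W P Z :: real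
  proof -
    have "t \<noteq> 0" "s \<noteq> 0" "t + s \<noteq> 0" using assms by auto
    then show ?thesis unfolding q_def by (simp add: divide_simps) (simp add: algebra_simps power2_eq_square)
  qed
  ultimately show ?thesis unfolding eq q_def[symmetric] eq' by (simp only: power2_norm_eq_inner)
qed

text \<open>Positive real factors split off a principal power, and
  \<open>inverse a powr e * a powr e = 1\<close> because \<open>a\<close> is off the branch cut. So
  of the three powers of \<open>a\<close> one survives, while the real factors multiply to
  \<open>4 * pi * (t + s)\<close>.\<close>

lemma heat_powr_semigroup:
  assumes "Re a > 0" "s > 0" "t > 0"
  shows "(of_real (4 * pi * t) * a) powr e * (of_real (4 * pi * s) * a) powr e *
    (of_real ((t + s) / (4 * t * s)) / a / of_real pi) powr e = (of_real (4 * pi * (t + s)) * a) powr e"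
proof -
  have a: "a \<notin> \<real>\<^sub>\<le>\<^sub>0" "a \<noteq> 0" using assms by (auto simp: complex_nonpos_Reals_iff)
  have inv: "inverse a powr e * a powr e = 1"
    using a by (simp add: powr_def Ln_inverse exp_minus)
  have "of_real ((t + s) / (4 * t * s)) / a / of_real pi = of_real ((t + s) / (4 * t * s * pi)) * inverse a"
    by (simp add: divide_simps)
  moreover have "(of_real r * z) powr e = of_real r powr e * z powr e" if "r > 0" for r z
    using that by (intro powr_times_real_left) auto
  moreover have "of_real (4 * pi * t) powr e * of_real (4 * pi * s) powr e * of_real ((t + s) / (4 * t * s * pi)) powr e =
     (of_real (4 * pi * (t + s)) :: complex) powr e"
  proof -
    have "4 * pi * (t + s) = 4 * pi * t * (4 * pi * s * ((t + s) / (4 * t * s * pi)))"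
      using assms by (simp add: field_simps)
    then have "complex_of_real (4 * pi * (t + s)) = of_real (4 * pi * t) * (of_real (4 * pi * s) * of_real ((t + s) / (4 * t * s * pi)))"
      by (simp only: of_real_mult)
    then show ?thesis
      using assms by (simp only:) (subst powr_times_real_left, simp, simp, subst powr_times_real_left, simp, simp, simp add: mult.assoc)
  qed
  ultimately have "(of_real (4 * pi * t) * a) powr e * (of_real (4 * pi * s) * a) powr e *
    (of_real ((t + s) / (4 * t * s)) / a / of_real pi) powr e =
    (of_real (4 * pi * (t + s)) :: complex) powr e * (inverse a powr e * a powr e) * a powr e"
    using assms by (simp add: mult_ac del: of_real_mult of_real_divide of_real_add)
  also have "\<dots> = (of_real (4 * pi * (t + s)) * a) powr e"
    unfolding inv using assms by (subst powr_times_real_left) auto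
  finally show ?thesis .
qed

lemma heat_coeff_convolution:
  fixes u y :: "'a::euclidean_space"
  assumes a: "Re a > 0" and st: "s > 0" "t > 0"
  shows "(\<integral>\<xi>. heat_coeff DIM('a) a b t ((norm (u - \<xi>))\<^sup>2) * heat_coeff DIM('a) a b s ((norm (\<xi> - y))\<^sup>2) \<partial>lborel) =
    heat_coeff DIM('a) a b (t + s) ((norm (u - y))\<^sup>2)"
proof -
  \<comment> \<open>The coefficient of the completed square, \<open>(t + s) / (t * s)\<close>,
    divided by the common \<open>4 * a\<close>. Inversion preserves the right half-plane, so
    \<open>Re c > 0\<close>.\<close>
  define c where "c = of_real ((t + s) / (4 * t * s)) / a"
  define m where "m = y + (s / (t + s)) *\<^sub>R (u - y)"
  let ?e = "- of_nat DIM('a) / 2 :: complex"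
  have a0: "a \<noteq> 0" using a by auto
  have c: "Re c > 0"
    using a st unfolding c_def divide_inverse by (simp add: cmod_power2[symmetric] a0)
  have exponent: "- of_real t * b - of_real ((norm (u - \<xi>))\<^sup>2) * inverse (of_real (4 * t) * a) +
       (- of_real s * b - of_real ((norm (\<xi> - y))\<^sup>2) * inverse (of_real (4 * s) * a)) =
     (- of_real (t + s) * b - of_real ((norm (u - y))\<^sup>2) * inverse (of_real (4 * (t + s)) * a)) + (- c * of_real ((norm (\<xi> - m))\<^sup>2))"
    (is "?l = ?r") for \<xi>
  proof -
    have "?l = - of_real (t + s) * b - of_real ((norm (u - \<xi>))\<^sup>2 / t + (norm (\<xi> - y))\<^sup>2 / s) / (4 * a)"
      using st a0 by (simp add: field_simps)
    also have "\<dots> = ?r"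
      unfolding gaussian_exponent_square[OF st, of u \<xi> y] m_def[symmetric] c_def
      by (simp add: field_simps add_divide_distrib)
    finally show ?thesis .
  qed
  have "(\<integral>\<xi>. heat_coeff DIM('a) a b t ((norm (u - \<xi>))\<^sup>2) * heat_coeff DIM('a) a b s ((norm (\<xi> - y))\<^sup>2) \<partial>lborel) =
     (\<integral>\<xi>. ((of_real (4 * pi * t) * a) powr ?e * (of_real (4 * pi * s) * a) powr ?e *
        exp (- of_real (t + s) * b - of_real ((norm (u - y))\<^sup>2) * inverse (of_real (4 * (t + s)) * a))) *
        exp (- c * of_real ((norm (\<xi> - m))\<^sup>2)) \<partial>lborel)"
  proof (rule Bochner_Integration.integral_cong[OF refl])
    fix \<xi>
    show "heat_coeff DIM('a) a b t ((norm (u - \<xi>))\<^sup>2) * heat_coeff DIM('a) a b s ((norm (\<xi> - y))\<^sup>2) =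
      ((of_real (4 * pi * t) * a) powr ?e * (of_real (4 * pi * s) * a) powr ?e *
        exp (- of_real (t + s) * b - of_real ((norm (u - y))\<^sup>2) * inverse (of_real (4 * (t + s)) * a))) *
        exp (- c * of_real ((norm (\<xi> - m))\<^sup>2))"
    proof -
      have "(p * exp e1) * (q * exp e2) = (p * q * exp e3) * exp e4" if "e1 + e2 = e3 + e4" for p q e1 e2 e3 e4 :: complex
        using arg_cong[OF that, of exp] by (simp add: exp_add)
      from this[OF exponent] show ?thesis unfolding heat_coeff_def .
    qed
  qed
  also have "\<dots> = ((of_real (4 * pi * t) * a) powr ?e * (of_real (4 * pi * s) * a) powr ?e *
        exp (- of_real (t + s) * b - of_real ((norm (u - y))\<^sup>2) * inverse (of_real (4 * (t + s)) * a))) *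
        (c / of_real pi) powr ?e"
    by (simp only: integral_mult_right_zero complex_gaussian_integral_shifted[OF c])
  also have "\<dots> = heat_coeff DIM('a) a b (t + s) ((norm (u - y))\<^sup>2)"
    unfolding heat_coeff_def heat_powr_semigroup[OF a st, symmetric] c_def by (simp only: mult_ac)
  finally show ?thesis .
qed

text \<open>The modulus of an exponential depends only on the real part of its exponent. Hence the
  decay rate is \<open>Re (inverse (of_real (4 * t) * a))\<close>, and everything free of
  \<open>r\<close> goes into \<open>M\<close>.\<close>

lemma heat_coeff_bound:
  assumes "Re a > 0" "t > 0"
  obtains M \<kappa> where "M \<ge> 0" "\<kappa> > 0" "\<And>r. norm (heat_coeff d a b t r) = M * exp (- \<kappa> * r)"
proof
  let ?M = "norm ((of_real (4 * pi * t) * a) powr (- of_nat d / 2) * exp (- of_real t * b))"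
  let ?\<kappa> = "Re (inverse (of_real (4 * t) * a))"
  have a0: "a \<noteq> 0" using assms by auto
  show "?M \<ge> 0" by simp
  show "?\<kappa> > 0" using assms by (simp add: cmod_power2[symmetric] a0)
  have "heat_coeff d a b t r = (of_real (4 * pi * t) * a) powr (- of_nat d / 2) * exp (- of_real t * b) *
     exp (of_real (- r) * inverse (of_real (4 * t) * a))" for r
    unfolding heat_coeff_def mult.assoc by (subst exp_add[symmetric]) simp
  moreover have "norm (exp (of_real (- r) * w)) = exp (- Re w * r)" for r and w :: complex
    by (simp add: norm_exp_eq_Re)
  ultimately show "norm (heat_coeff d a b t r) = ?M * exp (- ?\<kappa> * r)" for r
    by (simp only: norm_mult)
qed

lemma heat_coeff_continuous [continuous_intros]:
  assumes "continuous_on A f"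
  shows "continuous_on A (\<lambda>x. heat_coeff d a b t (f x))"
  unfolding heat_coeff_def by (intro continuous_intros assms)

section \<open>Kernel operators on weighted Lebesgue spaces\<close>

text \<open>The graph of the convex function \<open>g powr p\<close> lies above its tangent at
  \<open>m\<close>. The inequality is derived from Young's inequality with weights
  \<open>1/p\<close> and \<open>1 - 1/p\<close>.\<close>

lemma powr_tangent_bound:
  assumes "m > 0" "g \<ge> 0" "p \<ge> (1::real)"
  shows "p * m powr (p - 1) * g \<le> g powr p + (p - 1) * m powr p"
proof (cases "g = 0")
  case False
  then have g: "g > 0" using assms by simp
  have "(g powr p) powr (1/p) * (m powr p) powr (1 - 1/p) \<le> 1/p * g powr p + (1 - 1/p) * m powr p"
    using assms g by (intro Youngs_inequality_0) auto
  moreover have "(g powr p) powr (1/p) = g" using g assms by (simp add: powr_powr)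
  moreover have "(m powr p) powr (1 - 1/p) = m powr (p - 1)"
    using assms by (simp add: powr_powr right_diff_distrib)
  ultimately have "p * (g * m powr (p - 1)) \<le> p * (1/p * g powr p + (1 - 1/p) * m powr p)"
    using assms by (intro mult_left_mono) auto
  also have "\<dots> = g powr p + (p - 1) * m powr p" using assms by (simp add: distrib_left algebra_simps)
  finally show ?thesis by (simp add: mult_ac)
qed (use assms in simp)

text \<open>Jensen's inequality for the measure with density \<open>k\<close>, whose mass is
  \<open>K\<close> rather than 1. It is obtained by integrating the tangent inequality against
  \<open>k\<close>.\<close>

lemma nn_integral_powr_jensen:
  fixes k g :: "'a \<Rightarrow> real"
  assumes [measurable]: "k \<in> borel_measurable M" "g \<in> borel_measurable M"
    and nn: "\<And>x. k x \<ge> 0" "\<And>x. g x \<ge> 0"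
    and K: "(\<integral>\<^sup>+x. ennreal (k x) \<partial>M) = ennreal K" "K > 0"
    and p: "p \<ge> 1" and F: "F \<ge> 0" "ennreal F \<le> (\<integral>\<^sup>+x. ennreal (k x * g x) \<partial>M)"
  shows "ennreal (F powr p) \<le> ennreal (K powr (p - 1)) * (\<integral>\<^sup>+x. ennreal (k x * g x powr p) \<partial>M)"
proof (cases "F = 0 \<or> (\<integral>\<^sup>+x. ennreal (k x * g x powr p) \<partial>M) = \<infinity>")
  case True
  then show ?thesis using K p by (auto simp: ennreal_mult_top)
next
  case False
  then obtain J where J: "(\<integral>\<^sup>+x. ennreal (k x * g x powr p) \<partial>M) = ennreal J" "J \<ge> 0"
    by (cases "\<integral>\<^sup>+x. ennreal (k x * g x powr p) \<partial>M") auto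
  \<comment> \<open>The tangent is taken at the mean value \<open>F / K\<close>. There
    \<open>c * F\<close> equals \<open>p * (m powr p * K)\<close>, so subtracting the tangent's
    constant term leaves exactly \<open>m powr p * K\<close>.\<close>
  define m where "m = F / K"
  have m: "m > 0" "F = m * K" using False F K by (auto simp: m_def)
  define c where "c = p * m powr (p - 1)"
  have c: "c \<ge> 0" using p by (simp add: c_def)
  have "ennreal (c * F) \<le> ennreal c * (\<integral>\<^sup>+x. ennreal (k x * g x) \<partial>M)"
    using F c by (simp add: ennreal_mult mult_left_mono)
  also have "\<dots> = (\<integral>\<^sup>+x. ennreal c * ennreal (k x * g x) \<partial>M)"
    by (rule nn_integral_cmult[symmetric]) simp
  also have "\<dots> \<le> (\<integral>\<^sup>+x. ennreal (k x * g x powr p) + ennreal ((p - 1) * m powr p) * ennreal (k x) \<partial>M)"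
  proof (rule nn_integral_mono)
    fix x
    have "c * (k x * g x) \<le> k x * g x powr p + (p - 1) * m powr p * k x"
      using mult_left_mono[OF powr_tangent_bound[OF m(1) nn(2) p] nn(1), of x x]
      by (simp add: c_def algebra_simps)
    then show "ennreal c * ennreal (k x * g x) \<le> ennreal (k x * g x powr p) + ennreal ((p - 1) * m powr p) * ennreal (k x)"
      using c p nn by (simp flip: ennreal_mult ennreal_plus)
  qed
  also have "\<dots> = ennreal J + ennreal ((p - 1) * m powr p) * ennreal K"
    by (simp add: nn_integral_add nn_integral_cmult J K)
  also have "\<dots> = ennreal (J + (p - 1) * m powr p * K)"
    using J K p by (simp add: ennreal_mult)
  finally have "c * F \<le> J + (p - 1) * m powr p * K"
    using J K p by (subst (asm) ennreal_le_iff) auto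
  moreover have "c * F = p * (m powr p * K)"
    unfolding c_def m(2) using m(1) powr_add[of m "p - 1" 1] by simp
  ultimately have "m powr p * K \<le> J" by (simp add: algebra_simps)
  then have "m powr p * K * K powr (p - 1) \<le> J * K powr (p - 1)"
    by (rule mult_right_mono) simp
  moreover have "F powr p = m powr p * K * K powr (p - 1)"
    unfolding m(2) using m(1) K powr_add[of K "p - 1" 1] by (simp add: powr_mult)
  ultimately show ?thesis
    unfolding J by (simp add: ennreal_mult[symmetric] J mult.commute ennreal_leI)
qed

text \<open>Jensen in \<open>\<xi>\<close> uses the row integrals and costs
  \<open>K powr (p - 1)\<close>; Tonelli then uses the column integrals and costs another
  \<open>K\<close>. Together this is \<open>K powr p\<close>.\<close>

lemma schur_test:
  fixes k :: "'a::euclidean_space \<Rightarrow> 'a \<Rightarrow> real"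
  assumes k[measurable]: "case_prod k \<in> borel_measurable (lborel \<Otimes>\<^sub>M lborel)"
    and g[measurable]: "g \<in> borel_measurable lborel"
    and nn: "\<And>x \<xi>. k x \<xi> \<ge> 0" "\<And>\<xi>. g \<xi> \<ge> 0" "\<And>x. F x \<ge> 0"
    and K: "K > 0" "\<And>x. (\<integral>\<^sup>+\<xi>. ennreal (k x \<xi>) \<partial>lborel) = ennreal K"
           "\<And>\<xi>. (\<integral>\<^sup>+x. ennreal (k x \<xi>) \<partial>lborel) = ennreal K"
    and p: "p \<ge> 1" and F: "\<And>x. ennreal (F x) \<le> (\<integral>\<^sup>+\<xi>. ennreal (k x \<xi> * g \<xi>) \<partial>lborel)"
  shows "(\<integral>\<^sup>+x. ennreal (F x powr p) \<partial>lborel) \<le> ennreal (K powr p) * (\<integral>\<^sup>+\<xi>. ennreal (g \<xi> powr p) \<partial>lborel)"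
proof -
  have "(\<integral>\<^sup>+x. ennreal (F x powr p) \<partial>lborel) \<le>
      (\<integral>\<^sup>+x. ennreal (K powr (p - 1)) * (\<integral>\<^sup>+\<xi>. ennreal (k x \<xi> * g \<xi> powr p) \<partial>lborel) \<partial>lborel)"
    by (intro nn_integral_mono nn_integral_powr_jensen nn K p F) measurable
  also have "\<dots> = ennreal (K powr (p - 1)) * (\<integral>\<^sup>+x. \<integral>\<^sup>+\<xi>. ennreal (k x \<xi> * g \<xi> powr p) \<partial>lborel \<partial>lborel)"
    by (rule nn_integral_cmult) measurable
  also have "(\<integral>\<^sup>+x. \<integral>\<^sup>+\<xi>. ennreal (k x \<xi> * g \<xi> powr p) \<partial>lborel \<partial>lborel) =
      (\<integral>\<^sup>+\<xi>. \<integral>\<^sup>+x. ennreal (k x \<xi> * g \<xi> powr p) \<partial>lborel \<partial>lborel)"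
    by (rule lborel_pair.Fubini') measurable
  also have "\<dots> = (\<integral>\<^sup>+\<xi>. ennreal K * ennreal (g \<xi> powr p) \<partial>lborel)"
  proof (rule nn_integral_cong)
    fix \<xi>
    have "(\<integral>\<^sup>+x. ennreal (k x \<xi> * g \<xi> powr p) \<partial>lborel) = (\<integral>\<^sup>+x. ennreal (k x \<xi>) * ennreal (g \<xi> powr p) \<partial>lborel)"
      using nn by (simp add: ennreal_mult)
    also have "\<dots> = ennreal K * ennreal (g \<xi> powr p)"
      by (subst nn_integral_multc) (simp_all add: K)
    finally show "(\<integral>\<^sup>+x. ennreal (k x \<xi> * g \<xi> powr p) \<partial>lborel) = ennreal K * ennreal (g \<xi> powr p)" .
  qed
  also have "\<dots> = ennreal K * (\<integral>\<^sup>+\<xi>. ennreal (g \<xi> powr p) \<partial>lborel)"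
    by (rule nn_integral_cmult) measurable
  also have "ennreal (K powr (p - 1)) * (ennreal K * (\<integral>\<^sup>+\<xi>. ennreal (g \<xi> powr p) \<partial>lborel)) =
     ennreal (K powr p) * (\<integral>\<^sup>+\<xi>. ennreal (g \<xi> powr p) \<partial>lborel)"
    using K(1) powr_add[of K "p - 1" 1] by (simp add: mult.assoc[symmetric] ennreal_mult[symmetric])
  finally show ?thesis .
qed

lemma enn2real_ge_1: "1 \<le> p \<Longrightarrow> p \<noteq> \<infinity> \<Longrightarrow> 1 \<le> enn2real p"
  by (cases p) auto

text \<open>For finite \<open>p\<close> this is the \<open>p\<close>-th root of
  \<open>schur_test\<close>. For \<open>p = \<infinity>\<close> the essential supremum of
  \<open>f\<close> is pulled out of the integral and the row integral gives the factor
  \<open>K\<close>.\<close>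

lemma Lp_norm_schur:
  fixes k :: "'a::euclidean_space \<Rightarrow> 'a \<Rightarrow> real" and f :: "'a \<Rightarrow> 'b::euclidean_space" and F :: "'a \<Rightarrow> 'c::euclidean_space"
  assumes k[measurable]: "case_prod k \<in> borel_measurable (lborel \<Otimes>\<^sub>M lborel)"
    and f[measurable]: "f \<in> borel_measurable lborel"
    and Fm: "F \<in> borel_measurable lebesgue"
    and nn: "\<And>x \<xi>. k x \<xi> \<ge> 0"
    and K: "K > 0" "\<And>x. (\<integral>\<^sup>+\<xi>. ennreal (k x \<xi>) \<partial>lborel) = ennreal K"
           "\<And>\<xi>. (\<integral>\<^sup>+x. ennreal (k x \<xi>) \<partial>lborel) = ennreal K"
    and p: "1 \<le> p" and F: "\<And>x. ennreal (norm (F x)) \<le> (\<integral>\<^sup>+\<xi>. ennreal (k x \<xi> * norm (f \<xi>)) \<partial>lborel)"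
  shows "Lp_norm p F \<le> ennreal K * Lp_norm p f"
proof (cases "p = \<infinity>")
  case True
  let ?G = "esssup lebesgue (\<lambda>x. ennreal (norm (f x)))"
  have ae: "AE x in lborel. ennreal (norm (f x)) \<le> ?G"
    using esssup_AE[of "\<lambda>x. ennreal (norm (f x))" lebesgue] by (simp add: AE_completion_iff)
  have "ennreal (norm (F x)) \<le> ennreal K * ?G" for x
  proof -
    have "ennreal (norm (F x)) \<le> (\<integral>\<^sup>+\<xi>. ennreal (k x \<xi>) * ennreal (norm (f \<xi>)) \<partial>lborel)"
      using F[of x] nn by (simp add: ennreal_mult)
    also have "\<dots> \<le> (\<integral>\<^sup>+\<xi>. ennreal (k x \<xi>) * ?G \<partial>lborel)"
      by (rule nn_integral_mono_AE) (use ae in eventually_elim, auto intro: mult_left_mono)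
    also have "\<dots> = ennreal K * ?G"
      by (subst nn_integral_multc) (simp_all add: K)
    finally show ?thesis .
  qed
  then have "esssup lebesgue (\<lambda>x. ennreal (norm (F x))) \<le> ennreal K * ?G"
    using Fm by (intro esssup_I) auto
  with True show ?thesis by (simp add: Lp_norm_def)
next
  case False
  define q where "q = enn2real p"
  have q: "q \<ge> 1" using enn2real_ge_1[OF p False] by (simp add: q_def)
  define I where "I f = (\<integral>\<^sup>+x. ennreal (norm (f x) powr q) \<partial>lebesgue)" for f :: "'a \<Rightarrow> 'b"
  define J where "J = (\<integral>\<^sup>+x. ennreal (norm (F x) powr q) \<partial>lebesgue)"
  have le: "J \<le> ennreal (K powr q) * I f"
    unfolding I_def J_def nn_integral_completion
    by (rule schur_test[OF k _ nn _ _ K q F]) auto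
  have Lf: "Lp_norm p f = (if I f = \<infinity> then \<infinity> else ennreal (enn2real (I f) powr (1/q)))"
    and LF: "Lp_norm p F = (if J = \<infinity> then \<infinity> else ennreal (enn2real J powr (1/q)))"
    using False by (simp_all add: Lp_norm_def I_def J_def q_def)
  show ?thesis
  \<comment> \<open>In \<open>ennreal\<close> zero times infinity is zero, so the infinite case
    relies on \<open>K > 0\<close>.\<close>
  proof (cases "I f = \<infinity>")
    case True
    then show ?thesis using K by (simp add: Lf ennreal_mult_top)
  next
    case fin: False
    then obtain i where i: "I f = ennreal i" "i \<ge> 0" by (cases "I f") auto
    have leJ: "J \<le> ennreal (K powr q * i)" using le i by (simp add: ennreal_mult)
    then obtain j where j: "J = ennreal j" "j \<ge> 0" by (cases J) (auto simp: top_unique)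
    have "j \<le> K powr q * i" using leJ i j by (simp add: ennreal_le_iff)
    then have "j powr (1/q) \<le> (K powr q * i) powr (1/q)"
      using j q by (intro powr_mono2) auto
    also have "\<dots> = K * i powr (1/q)" using K(1) q i by (simp add: powr_mult powr_powr)
    finally have "ennreal (j powr (1/q)) \<le> ennreal K * ennreal (i powr (1/q))"
      using K(1) by (simp add: ennreal_mult[symmetric] ennreal_leI)
    then show ?thesis by (simp add: Lf LF i j)
  qed
qed

lemma Lp_norm_cong_AE:
  assumes "f \<in> borel_measurable lebesgue" "g \<in> borel_measurable lebesgue" "AE x in lebesgue. f x = g x"
  shows "Lp_norm p f = Lp_norm p g"
proof -
  have "esssup lebesgue (\<lambda>x. ennreal (norm (f x))) = esssup lebesgue (\<lambda>x. ennreal (norm (g x)))"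
    using assms by (intro esssup_AE_cong) auto
  moreover have "(\<integral>\<^sup>+x. ennreal (norm (f x) powr enn2real p) \<partial>lebesgue) = (\<integral>\<^sup>+x. ennreal (norm (g x) powr enn2real p) \<partial>lebesgue)"
    using assms(3) by (intro nn_integral_cong_AE) auto
  ultimately show ?thesis by (simp add: Lp_norm_def)
qed

section \<open>Gaussians against weights, and representatives of elements of the space\<close>

lemma weight_function_measurable:
  assumes "weight_function \<theta> \<eta>"
  shows "\<theta> \<in> borel_measurable borel"
  using assms by (intro borel_measurable_continuous_onI) (simp add: weight_function_def)

lemma weight_gaussian_bound:
  fixes \<theta> :: "'a::real_normed_vector \<Rightarrow> real"
  assumes "weight_function \<theta> \<eta>" "\<kappa> > 0"
  obtains C where "C > 0" "\<And>z \<xi>. \<theta> z * exp (- \<kappa> * (norm (z - \<xi>))\<^sup>2) \<le> C * exp (- (\<kappa> / 2) * (norm (z - \<xi>))\<^sup>2) * \<theta> \<xi>"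
proof -
  obtain C where C: "C > 0" "\<And>x y. \<theta> (x + y) \<le> C * \<theta> x * exp (\<eta> * norm y)"
    and pos: "\<And>x. \<theta> x > 0"
    using assms by (auto simp: weight_function_def)
  show ?thesis
  proof
    \<comment> \<open>The maximum over \<open>r\<close> of
      \<open>exp (\<eta> * r - \<kappa> / 2 * r^2)\<close>, attained at
      \<open>r = \<eta> / \<kappa>\<close>: the price of absorbing the exponential growth into half
      of the Gaussian.\<close>
    show "C * exp (\<eta>\<^sup>2 / (2 * \<kappa>)) > 0" using C by simp
    fix z \<xi> :: 'a
    define r where "r = norm (z - \<xi>)"
    have "0 \<le> \<kappa> / 2 * (r - \<eta> / \<kappa>)\<^sup>2" using assms by simp
    also have "\<dots> = \<kappa> / 2 * r\<^sup>2 - \<eta> * r + \<eta>\<^sup>2 / (2 * \<kappa>)"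
      using assms by (simp add: power2_eq_square field_simps)
    finally have e: "\<eta> * r + - \<kappa> * r\<^sup>2 \<le> \<eta>\<^sup>2 / (2 * \<kappa>) + - (\<kappa> / 2) * r\<^sup>2" by simp
    have "\<theta> z * exp (- \<kappa> * r\<^sup>2) \<le> C * \<theta> \<xi> * exp (\<eta> * r) * exp (- \<kappa> * r\<^sup>2)"
      using C(2)[of \<xi> "z - \<xi>"] by (intro mult_right_mono) (simp_all add: r_def)
    also have "\<dots> = C * \<theta> \<xi> * exp (\<eta> * r + - \<kappa> * r\<^sup>2)" by (simp only: exp_add mult.assoc)
    also have "\<dots> \<le> C * \<theta> \<xi> * exp (\<eta>\<^sup>2 / (2 * \<kappa>) + - (\<kappa> / 2) * r\<^sup>2)"
      using e C(1) pos[of \<xi>] by (intro mult_left_mono) auto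
    also have "\<dots> = C * exp (\<eta>\<^sup>2 / (2 * \<kappa>)) * exp (- (\<kappa> / 2) * r\<^sup>2) * \<theta> \<xi>"
      by (simp only: exp_add mult_ac)
    finally show "\<theta> z * exp (- \<kappa> * (norm (z - \<xi>))\<^sup>2) \<le>
        C * exp (\<eta>\<^sup>2 / (2 * \<kappa>)) * exp (- (\<kappa> / 2) * (norm (z - \<xi>))\<^sup>2) * \<theta> \<xi>"
      by (simp only: r_def)
  qed
qed

text \<open>For finite exponents an elementary bound takes the place of Hoelder's inequality: since
  the Gaussian is at most 1, \<open>?k \<xi> * norm (f \<xi>)\<close> is at most
  \<open>?k \<xi>\<close> where \<open>norm (f \<xi>) \<le> 1\<close>, and at most
  \<open>norm (f \<xi>) powr q\<close> elsewhere.\<close>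

lemma nn_integral_gaussian_Lp:
  fixes f :: "'a::euclidean_space \<Rightarrow> 'b::euclidean_space"
  assumes f[measurable]: "f \<in> borel_measurable lebesgue" and p: "1 \<le> p" and fin: "Lp_norm p f < \<infinity>" and \<kappa>: "\<kappa> > 0"
  shows "(\<integral>\<^sup>+\<xi>. ennreal (exp (- \<kappa> * (norm (z - \<xi>))\<^sup>2) * norm (f \<xi>)) \<partial>lebesgue) < \<infinity>"
proof -
  let ?k = "\<lambda>\<xi>. exp (- \<kappa> * (norm (z - \<xi>))\<^sup>2)"
  have km[measurable]: "?k \<in> borel_measurable lebesgue"
    by (intro measurable_completion) simp
  have k: "(\<integral>\<^sup>+\<xi>. ennreal (?k \<xi>) \<partial>lebesgue) < \<infinity>"
    using nn_integral_gaussian_shifted[OF \<kappa>, of z]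
    by (simp add: nn_integral_completion norm_minus_commute)
  show ?thesis
  proof (cases "p = \<infinity>")
    case True
    let ?G = "esssup lebesgue (\<lambda>x. ennreal (norm (f x)))"
    have "(\<integral>\<^sup>+\<xi>. ennreal (?k \<xi> * norm (f \<xi>)) \<partial>lebesgue) \<le> (\<integral>\<^sup>+\<xi>. ennreal (?k \<xi>) * ?G \<partial>lebesgue)"
      by (rule nn_integral_mono_AE) (use esssup_AE[of "\<lambda>x. ennreal (norm (f x))" lebesgue] in eventually_elim,
          auto simp: ennreal_mult intro: mult_left_mono)
    also have "\<dots> = (\<integral>\<^sup>+\<xi>. ennreal (?k \<xi>) \<partial>lebesgue) * ?G"
      by (rule nn_integral_multc) measurable
    also have "\<dots> < \<infinity>"
      using k fin True by (simp add: Lp_norm_def ennreal_mult_less_top)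
    finally show ?thesis .
  next
    case False
    define q where "q = enn2real p"
    have q: "q \<ge> 1" using enn2real_ge_1[OF p False] by (simp add: q_def)
    have fin: "(\<integral>\<^sup>+x. ennreal (norm (f x) powr q) \<partial>lebesgue) < \<infinity>"
      using fin False by (auto simp: Lp_norm_def Let_def q_def less_top split: if_splits)
    have "(\<integral>\<^sup>+\<xi>. ennreal (?k \<xi> * norm (f \<xi>)) \<partial>lebesgue) \<le>
        (\<integral>\<^sup>+\<xi>. ennreal (?k \<xi>) + ennreal (norm (f \<xi>) powr q) \<partial>lebesgue)"
    proof (rule nn_integral_mono)
      fix \<xi>
      have k1: "?k \<xi> \<le> 1" "?k \<xi> \<ge> 0" using \<kappa> by auto
      have "?k \<xi> * norm (f \<xi>) \<le> ?k \<xi> + norm (f \<xi>) powr q"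
      proof (cases "norm (f \<xi>) \<le> 1")
        case True
        then have "?k \<xi> * norm (f \<xi>) \<le> ?k \<xi> * 1" using k1 by (intro mult_left_mono) auto
        then show ?thesis by (simp add: add_increasing2)
      next
        case False
        then have "norm (f \<xi>) powr 1 \<le> norm (f \<xi>) powr q" using q by (intro powr_mono) auto
        moreover have "?k \<xi> * norm (f \<xi>) \<le> 1 * norm (f \<xi>)" using k1 by (intro mult_right_mono) auto
        moreover have "norm (f \<xi>) powr 1 = norm (f \<xi>)" by simp
        ultimately show ?thesis using k1(2) by linarith
      qed
      then show "ennreal (?k \<xi> * norm (f \<xi>)) \<le> ennreal (?k \<xi>) + ennreal (norm (f \<xi>) powr q)"
        by (simp flip: ennreal_plus)
    qed
    also have "\<dots> = (\<integral>\<^sup>+\<xi>. ennreal (?k \<xi>) \<partial>lebesgue) + (\<integral>\<^sup>+x. ennreal (norm (f x) powr q) \<partial>lebesgue)"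
      by (rule nn_integral_add) measurable
    also have "\<dots> < \<infinity>" using k fin by simp
    finally show ?thesis .
  qed
qed

text \<open>With the centre \<open>z\<close> fixed, \<open>\<theta> z\<close> is a positive
  constant. Dividing the weight bound by it trades half of the Gaussian for a factor
  \<open>\<theta> \<xi>\<close>, so the unweighted statement applies to
  \<open>\<theta> \<xi> *\<^sub>R v \<xi>\<close>.\<close>

lemma integrable_gaussian_weighted_Lp:
  fixes v :: "'a::euclidean_space \<Rightarrow> 'b::euclidean_space"
  assumes v[measurable]: "v \<in> borel_measurable lebesgue" and p: "1 \<le> p" and fin: "weighted_Lp_norm p \<theta> v < \<infinity>"
    and \<theta>: "weight_function \<theta> \<eta>" and \<kappa>: "\<kappa> > 0"
  shows "integrable lebesgue (\<lambda>\<xi>. exp (- \<kappa> * (norm (z - \<xi>))\<^sup>2) *\<^sub>R v \<xi>)"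
proof (rule integrableI_bounded)
  have \<theta>m[measurable]: "\<theta> \<in> borel_measurable lebesgue"
    using weight_function_measurable[OF \<theta>] by (intro measurable_completion) simp
  have km[measurable]: "(\<lambda>\<xi>. exp (- \<kappa> * (norm (z - \<xi>))\<^sup>2)) \<in> borel_measurable lebesgue" for \<kappa>
    by (intro measurable_completion) simp
  show "(\<lambda>\<xi>. exp (- \<kappa> * (norm (z - \<xi>))\<^sup>2) *\<^sub>R v \<xi>) \<in> borel_measurable lebesgue" by measurable
  obtain C where C: "C > 0" "\<And>z \<xi>. \<theta> z * exp (- \<kappa> * (norm (z - \<xi>))\<^sup>2) \<le> C * exp (- (\<kappa> / 2) * (norm (z - \<xi>))\<^sup>2) * \<theta> \<xi>"
    by (rule weight_gaussian_bound[OF \<theta> \<kappa>]) blast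
  have pos: "\<theta> x > 0" for x using \<theta> by (simp add: weight_function_def)
  let ?g = "\<lambda>\<xi>. exp (- (\<kappa> / 2) * (norm (z - \<xi>))\<^sup>2) * norm (\<theta> \<xi> *\<^sub>R v \<xi>)"
  have "(\<integral>\<^sup>+\<xi>. ennreal (norm (exp (- \<kappa> * (norm (z - \<xi>))\<^sup>2) *\<^sub>R v \<xi>)) \<partial>lebesgue) \<le>
     (\<integral>\<^sup>+\<xi>. ennreal (C / \<theta> z) * ennreal (?g \<xi>) \<partial>lebesgue)"
  proof (rule nn_integral_mono)
    fix \<xi>
    have "norm (exp (- \<kappa> * (norm (z - \<xi>))\<^sup>2) *\<^sub>R v \<xi>) \<le> C / \<theta> z * ?g \<xi>"
      using mult_right_mono[OF C(2)[of z \<xi>], of "norm (v \<xi>) / \<theta> z"] pos[of z] pos[of \<xi>]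
      by (simp add: abs_of_pos mult_ac)
    then show "ennreal (norm (exp (- \<kappa> * (norm (z - \<xi>))\<^sup>2) *\<^sub>R v \<xi>)) \<le> ennreal (C / \<theta> z) * ennreal (?g \<xi>)"
      using C(1) pos[of z] by (subst ennreal_mult[symmetric]) (auto intro: ennreal_leI)
  qed
  also have "\<dots> = ennreal (C / \<theta> z) * (\<integral>\<^sup>+\<xi>. ennreal (?g \<xi>) \<partial>lebesgue)"
    by (rule nn_integral_cmult) measurable
  also have "\<dots> < \<infinity>"
  proof -
    have "(\<integral>\<^sup>+\<xi>. ennreal (?g \<xi>) \<partial>lebesgue) < \<infinity>"
      by (rule nn_integral_gaussian_Lp[OF _ p]) (use fin \<kappa> in \<open>simp_all add: weighted_Lp_norm_def\<close>)
    then show ?thesis by (simp add: ennreal_mult_less_top)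
  qed
  finally show "(\<integral>\<^sup>+\<xi>. ennreal (norm (exp (- \<kappa> * (norm (z - \<xi>))\<^sup>2) *\<^sub>R v \<xi>)) \<partial>lebesgue) < \<infinity>" .
qed

text \<open>Local integrability comes from the integrability of \<open>v\<close> against a Gaussian:
  on a compact set inside the ball of radius \<open>R\<close>, the Gaussian
  \<open>exp (- (norm x)^2)\<close> is at least \<open>exp (- R^2)\<close>.\<close>

lemma weighted_Lp_iff:
  fixes v :: "'a::euclidean_space \<Rightarrow> 'b::euclidean_space"
  assumes p: "1 \<le> p" and \<theta>: "weight_function \<theta> \<eta>"
  shows "v \<in> weighted_Lp p \<theta> \<longleftrightarrow> v \<in> borel_measurable lebesgue \<and> weighted_Lp_norm p \<theta> v < \<infinity>"
proof -
  have "locally_integrable v" if v: "v \<in> borel_measurable lebesgue" and fin: "weighted_Lp_norm p \<theta> v < \<infinity>"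
    unfolding locally_integrable_def
  proof (intro conjI allI impI v)
    fix K :: "'a set" assume "compact K"
    then obtain R where R: "\<And>x. x \<in> K \<Longrightarrow> norm x \<le> R"
      using compact_imp_bounded bounded_iff by metis
    have K: "K \<in> sets lebesgue" using \<open>compact K\<close> by (simp add: compact_imp_closed borel_closed)
    have i: "integrable lebesgue (\<lambda>\<xi>. exp (- 1 * (norm (0 - \<xi>))\<^sup>2) *\<^sub>R v \<xi>)"
      by (rule integrable_gaussian_weighted_Lp[OF v p fin \<theta>]) simp
    show "v absolutely_integrable_on K"
      unfolding set_integrable_def
    proof (rule Bochner_Integration.integrable_bound)
      show "integrable lebesgue (\<lambda>\<xi>. exp (R\<^sup>2) *\<^sub>R (exp (- 1 * (norm (0 - \<xi>))\<^sup>2) *\<^sub>R v \<xi>))"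
        by (intro integrable_scaleR_right i)
      show "(\<lambda>x. indicat_real K x *\<^sub>R v x) \<in> borel_measurable lebesgue"
        using v K by measurable
      show "AE x in lebesgue. norm (indicat_real K x *\<^sub>R v x) \<le> norm (exp (R\<^sup>2) *\<^sub>R (exp (- 1 * (norm (0 - x))\<^sup>2) *\<^sub>R v x))"
      proof (rule AE_I2)
        fix x
        have "1 \<le> exp (R\<^sup>2) * exp (- (norm x)\<^sup>2)" if "x \<in> K"
          using power_mono[OF R[OF that], of 2] by (simp flip: exp_add)
        from mult_right_mono[OF this, of "norm (v x)"]
        show "norm (indicat_real K x *\<^sub>R v x) \<le> norm (exp (R\<^sup>2) *\<^sub>R (exp (- 1 * (norm (0 - x))\<^sup>2) *\<^sub>R v x))"
          by (auto simp: indicator_def mult.assoc)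
      qed
    qed
  qed
  then show ?thesis by (auto simp: weighted_Lp_def locally_integrable_def)
qed

text \<open>Prepares for iterated integrals: Lebesgue measurability of \<open>v\<close> does not by
  itself give measurability over the product of the Borel spaces, while that of \<open>w\<close>
  does. The real-valued result is applied to each of the finitely many coordinates.\<close>

lemma lebesgue_measurable_borel_representative:
  fixes v :: "'a::euclidean_space \<Rightarrow> 'b::euclidean_space"
  assumes "v \<in> borel_measurable lebesgue"
  obtains w where "w \<in> borel_measurable lborel" "AE x in lborel. v x = w x"
proof -
  have "\<exists>g\<in>borel_measurable lborel. AE x in lborel. v x \<bullet> b = g x" for b
    using assms by (intro completion_ex_borel_measurable_real) simp
  then obtain g where g: "\<And>b. g b \<in> borel_measurable lborel" "\<And>b. AE x in lborel. v x \<bullet> b = g b x"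
    by metis
  have "AE x in lborel. \<forall>b\<in>Basis. v x \<bullet> b = g b x"
    using g(2) by (intro AE_finite_allI) auto
  then have "AE x in lborel. v x = (\<Sum>b\<in>Basis. g b x *\<^sub>R b)"
  proof eventually_elim
    case (elim x)
    have "v x = (\<Sum>b\<in>Basis. (v x \<bullet> b) *\<^sub>R b)" by (simp add: euclidean_representation)
    also have "\<dots> = (\<Sum>b\<in>Basis. g b x *\<^sub>R b)" using elim by (intro sum.cong) auto
    finally show ?case .
  qed
  moreover have "(\<lambda>x. \<Sum>b\<in>Basis. g b x *\<^sub>R b) \<in> borel_measurable lborel"
    using g(1) by measurable
  ultimately show ?thesis using that by blast
qed

section \<open>The semigroup\<close>

lemma borel_measurable_vecI:
  fixes f :: "'a \<Rightarrow> 'b::euclidean_space ^ 'n"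
  assumes "\<And>i. (\<lambda>x. f x $ i) \<in> borel_measurable M"
  shows "f \<in> borel_measurable M"
proof (subst borel_measurable_euclidean_space, intro ballI)
  fix b :: "'b ^ 'n" assume "b \<in> Basis"
  then obtain i u where "b = axis i u" by (auto simp: Basis_vec_def)
  then show "(\<lambda>x. f x \<bullet> b) \<in> borel_measurable M"
    using assms[of i] by (simp add: inner_axis)
qed

lemma borel_measurable_vec_nth:
  fixes f :: "'a \<Rightarrow> 'b::euclidean_space ^ 'n"
  assumes "f \<in> borel_measurable M"
  shows "(\<lambda>x. f x $ i) \<in> borel_measurable M"
  by (rule borel_measurable_continuous_on[OF _ assms]) (intro continuous_intros)

lemma borel_measurable_matrix_vector_mult:
  fixes Y :: "complex ^ 'n ^ 'm"
  assumes "f \<in> borel_measurable M"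
  shows "(\<lambda>x. Y *v f x) \<in> borel_measurable M"
  by (rule borel_measurable_continuous_on[OF _ assms]) (intro continuous_intros)

lemma matrix_vector_mult_scaleR_complex:
  "(M :: complex ^ 'n ^ 'm) *v (r *\<^sub>R x) = r *\<^sub>R (M *v x)"
  by (simp add: matrix_vector_mult_def vec_eq_iff scaleR_sum_right)

lemma norm_vec_le_sum: "norm (z :: 'b::real_normed_vector ^ 'n) \<le> (\<Sum>k\<in>UNIV. norm (z $ k))"
  unfolding norm_vec_def by (rule L2_set_le_sum) simp

text \<open>Serves as the dominating function when the two integrations of a composed operator are
  exchanged; the variables are decoupled here.\<close>

lemma integrable_product_gaussian:
  fixes \<phi> :: "'b::euclidean_space \<Rightarrow> complex" and u :: "'a::euclidean_space"
  assumes "\<kappa> > 0" and \<phi>: "integrable lborel \<phi>"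
  shows "integrable (lborel \<Otimes>\<^sub>M lborel) (\<lambda>(\<xi>, y). exp (- \<kappa> * (norm (\<xi> - u))\<^sup>2) *\<^sub>R \<phi> y)"
proof -
  have m[measurable]: "\<phi> \<in> borel_measurable borel" using \<phi> by auto
  have i: "integrable lborel (\<lambda>\<xi>. exp (- \<kappa> * (norm (\<xi> - u))\<^sup>2))"
    using nn_integral_gaussian_shifted[OF assms(1), of u] by (intro integrableI_bounded) auto
  show ?thesis
    unfolding split_beta
  proof (rule lborel_pair.Fubini_integrable)
    show "integrable lborel (\<lambda>\<xi>. \<integral>y. norm (exp (- \<kappa> * (norm (fst (\<xi>, y) - u))\<^sup>2) *\<^sub>R \<phi> (snd (\<xi>, y))) \<partial>lborel)"
      using i by simp
    show "AE \<xi> in lborel. integrable lborel (\<lambda>y. exp (- \<kappa> * (norm (fst (\<xi>, y) - u))\<^sup>2) *\<^sub>R \<phi> (snd (\<xi>, y)))"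
      using \<phi> by simp
  qed measurable
qed

text \<open>After the exchange of integrals, \<open>y\<close> is fixed and the rotation
  \<open>E s\<close> is moved from \<open>\<xi>\<close> onto \<open>y\<close>. The integral over
  \<open>\<xi>\<close> is then an unrotated convolution between \<open>E t x\<close> and
  \<open>E (- s) y\<close>, and their distance is that of \<open>E (t + s) x\<close> and
  \<open>y\<close>.\<close>

lemma heat_coeff_Chapman_Kolmogorov:
  fixes S :: "real ^ 'd ^ 'd" and \<phi> :: "real ^ 'd \<Rightarrow> complex"
  defines "E \<equiv> \<lambda>t x. matrix_exp (t *\<^sub>R S) *v x"
  assumes skew: "transpose S = - S" and a: "Re a > 0" and st: "s > 0" "t > 0"
    and \<phi>m[measurable]: "\<phi> \<in> borel_measurable borel"
    and \<phi>: "\<And>z \<kappa>. \<kappa> > 0 \<Longrightarrow> integrable lborel (\<lambda>\<xi>. exp (- \<kappa> * (norm (z - \<xi>))\<^sup>2) *\<^sub>R \<phi> \<xi>)"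
  shows "(\<integral>\<xi>. heat_coeff CARD('d) a b t ((norm (E t x - \<xi>))\<^sup>2) *
       (\<integral>y. heat_coeff CARD('d) a b s ((norm (E s \<xi> - y))\<^sup>2) * \<phi> y \<partial>lborel) \<partial>lborel) =
    (\<integral>y. heat_coeff CARD('d) a b (t + s) ((norm (E (t + s) x - y))\<^sup>2) * \<phi> y \<partial>lborel)"
proof -
  let ?h = "heat_coeff CARD('d) a b"
  define u where "u = E t x"
  have swap: "norm (E r z - y) = norm (z - E (- r) y)" for r z y
    unfolding E_def by (rule norm_matrix_exp_skew_diff[OF skew])
  obtain M1 \<kappa>1 where 1: "M1 \<ge> 0" "\<kappa>1 > 0" "\<And>r. norm (?h t r) = M1 * exp (- \<kappa>1 * r)"
    using heat_coeff_bound[OF a st(2)] by blast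
  obtain M2 \<kappa>2 where 2: "M2 \<ge> 0" "\<kappa>2 > 0" "\<And>r. norm (?h s r) = M2 * exp (- \<kappa>2 * r)"
    using heat_coeff_bound[OF a st(1)] by blast
  define \<kappa> where "\<kappa> = min \<kappa>1 \<kappa>2"
  have \<kappa>: "\<kappa> > 0" "\<kappa> \<le> \<kappa>1" "\<kappa> \<le> \<kappa>2" using 1 2 by (auto simp: \<kappa>_def)
  have hm[measurable]: "?h r \<in> borel_measurable borel" for r
    by (intro borel_measurable_continuous_onI continuous_intros)
  have Em[measurable]: "E r \<in> borel_measurable borel" for r
    unfolding E_def by (intro borel_measurable_continuous_onI continuous_intros)
  let ?f = "\<lambda>\<xi> y. ?h t ((norm (u - \<xi>))\<^sup>2) * (?h s ((norm (E s \<xi> - y))\<^sup>2) * \<phi> y)"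
  have "integrable (lborel \<Otimes>\<^sub>M lborel) (\<lambda>(\<xi>, y). ?f \<xi> y)"
  proof (rule Bochner_Integration.integrable_bound)
    \<comment> \<open>The decay in \<open>y\<close> is centred at \<open>E s u\<close>, which does
      not involve \<open>\<xi>\<close>. Writing \<open>p\<close>, \<open>q\<close>, \<open>r\<close>
      for the squared distances below, \<open>r \<le> 2 * p + 2 * q\<close> shows that rate
      \<open>\<kappa> / 4\<close> in \<open>r\<close> is paid for by \<open>\<kappa> / 2\<close> in
      \<open>p\<close> and in \<open>q\<close>, and \<open>\<kappa> / 2\<close> in \<open>p\<close>
      is left for \<open>\<xi>\<close>.\<close>
    show "integrable (lborel \<Otimes>\<^sub>M lborel) (\<lambda>z. (M1 * M2) *\<^sub>R
       (case z of (\<xi>, y) \<Rightarrow> exp (- (\<kappa> / 2) * (norm (\<xi> - u))\<^sup>2) *\<^sub>R (exp (- (\<kappa> / 4) * (norm (E s u - y))\<^sup>2) *\<^sub>R \<phi> y)))"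
      using \<kappa> by (intro integrable_scaleR_right integrable_product_gaussian \<phi>) auto
    show "(\<lambda>(\<xi>, y). ?f \<xi> y) \<in> borel_measurable (lborel \<Otimes>\<^sub>M lborel)" by measurable
    show "AE z in lborel \<Otimes>\<^sub>M lborel. norm (case z of (\<xi>, y) \<Rightarrow> ?f \<xi> y) \<le> norm ((M1 * M2) *\<^sub>R
       (case z of (\<xi>, y) \<Rightarrow> exp (- (\<kappa> / 2) * (norm (\<xi> - u))\<^sup>2) *\<^sub>R (exp (- (\<kappa> / 4) * (norm (E s u - y))\<^sup>2) *\<^sub>R \<phi> y)))"
    proof (rule AE_I2, clarify)
      fix \<xi> y
      define p where "p = (norm (u - \<xi>))\<^sup>2"
      define q where "q = (norm (E s \<xi> - y))\<^sup>2"
      define r where "r = (norm (E s u - y))\<^sup>2"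
      have nn: "p \<ge> 0" "q \<ge> 0" by (simp_all add: p_def q_def)
      \<comment> \<open>Pulled back by the isometry, both distances end at \<open>E (- s) y\<close>,
        so the triangle inequality can pass through \<open>\<xi>\<close>.\<close>
      have "norm (u - E (- s) y) \<le> norm (u - \<xi>) + norm (\<xi> - E (- s) y)"
        using norm_triangle_ineq[of "u - \<xi>" "\<xi> - E (- s) y"] by simp
      then have "r \<le> (norm (u - \<xi>) + norm (E s \<xi> - y))\<^sup>2"
        unfolding r_def swap by (intro power_mono) auto
      also have "\<dots> \<le> 2 * p + 2 * q"
        using sum_squares_bound[of "norm (u - \<xi>)" "norm (E s \<xi> - y)"]
        by (simp add: p_def q_def power2_sum)
      finally have "\<kappa> / 4 * r \<le> \<kappa> / 2 * p + \<kappa> / 2 * q"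
        using mult_left_mono[of r "2 * p + 2 * q" "\<kappa> / 4"] \<kappa>(1) by (simp add: algebra_simps)
      moreover have "\<kappa> * p \<le> \<kappa>1 * p" "\<kappa> * q \<le> \<kappa>2 * q" "0 \<le> \<kappa> * q"
        using \<kappa> nn by (auto intro: mult_right_mono)
      ultimately have "- \<kappa>1 * p + - \<kappa>2 * q \<le> - (\<kappa> / 2) * p + - (\<kappa> / 4) * r" by simp
      then have "exp (- \<kappa>1 * p) * exp (- \<kappa>2 * q) \<le> exp (- (\<kappa> / 2) * p) * exp (- (\<kappa> / 4) * r)"
        by (simp only: exp_add[symmetric] exp_le_cancel_iff)
      then have "(M1 * M2 * norm (\<phi> y)) * (exp (- \<kappa>1 * p) * exp (- \<kappa>2 * q)) \<le>
         (M1 * M2 * norm (\<phi> y)) * (exp (- (\<kappa> / 2) * p) * exp (- (\<kappa> / 4) * r))"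
        using 1 2 by (intro mult_left_mono) auto
      moreover have "norm (?f \<xi> y) = (M1 * M2 * norm (\<phi> y)) * (exp (- \<kappa>1 * p) * exp (- \<kappa>2 * q))"
        by (simp only: norm_mult 1(3) 2(3) p_def q_def mult_ac)
      moreover have "norm ((M1 * M2) *\<^sub>R (exp (- (\<kappa> / 2) * (norm (\<xi> - u))\<^sup>2) *\<^sub>R (exp (- (\<kappa> / 4) * (norm (E s u - y))\<^sup>2) *\<^sub>R \<phi> y))) =
         (M1 * M2 * norm (\<phi> y)) * (exp (- (\<kappa> / 2) * p) * exp (- (\<kappa> / 4) * r))"
        using 1 2 by (simp add: p_def r_def norm_minus_commute[of \<xi>])
      ultimately show "norm (?f \<xi> y) \<le> norm ((M1 * M2) *\<^sub>R (exp (- (\<kappa> / 2) * (norm (\<xi> - u))\<^sup>2) *\<^sub>R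
         (exp (- (\<kappa> / 4) * (norm (E s u - y))\<^sup>2) *\<^sub>R \<phi> y)))"
        by (simp only:)
    qed
  qed
  then have "(\<integral>\<xi>. \<integral>y. ?f \<xi> y \<partial>lborel \<partial>lborel) = (\<integral>y. \<integral>\<xi>. ?f \<xi> y \<partial>lborel \<partial>lborel)"
    by (rule lborel_pair.Fubini_integral[symmetric])
  also have "\<dots> = (\<integral>y. ?h (t + s) ((norm (E (t + s) x - y))\<^sup>2) * \<phi> y \<partial>lborel)"
  proof (rule Bochner_Integration.integral_cong[OF refl])
    fix y
    \<comment> \<open>Read backwards, the transfer of the rotation gives
      \<open>norm (E s u - y)\<close>, and the group law turns \<open>E s u\<close> into
      \<open>E (s + t) x\<close>.\<close>
    have "norm (u - E (- s) y) = norm (E (s + t) x - y)"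
      unfolding swap[symmetric] by (simp add: u_def E_def matrix_exp_skew_add[OF skew])
    then have eq: "norm (u - E (- s) y) = norm (E (t + s) x - y)" by (simp only: add.commute)
    have "(\<integral>\<xi>. ?f \<xi> y \<partial>lborel) = (\<integral>\<xi>. ?h t ((norm (u - \<xi>))\<^sup>2) * ?h s ((norm (\<xi> - E (- s) y))\<^sup>2) * \<phi> y \<partial>lborel)"
      by (simp only: swap mult.assoc)
    also have "\<dots> = ?h (t + s) ((norm (u - E (- s) y))\<^sup>2) * \<phi> y"
      using heat_coeff_convolution[OF a st, of b u "E (- s) y"] by simp
    finally show "(\<integral>\<xi>. ?f \<xi> y \<partial>lborel) = ?h (t + s) ((norm (E (t + s) x - y))\<^sup>2) * \<phi> y"
      by (simp only: eq)
  qed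
  finally show ?thesis by (simp add: u_def)
qed

text \<open>One simultaneous diagonalisation is fixed throughout, so that the system decouples into
  scalar kernels \<open>h k\<close> in the coordinates given by \<open>matrix_inv Y\<close>.\<close>

locale OU_system =
  fixes Y :: "complex ^ 'n ^ 'n" and l m :: "'n \<Rightarrow> complex" and S :: "real ^ 'd ^ 'd"
    and p :: ennreal and \<theta> :: "real ^ 'd \<Rightarrow> real" and \<eta> :: real
  assumes invertible: "invertible Y" and Re_pos: "\<And>k. Re (l k) > 0"
    and skew: "transpose S = - S" and p: "1 \<le> p"
    and weight: "weight_function \<theta> \<eta>" and radial: "radial \<theta>"
begin

abbreviation "A \<equiv> Y ** diag_matrix l ** matrix_inv Y"
abbreviation "B \<equiv> Y ** diag_matrix m ** matrix_inv Y"
abbreviation "E t x \<equiv> matrix_exp (t *\<^sub>R S) *v x"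
abbreviation "h k t x \<xi> \<equiv> heat_coeff CARD('d) (l k) (m k) t ((norm (E t x - \<xi>))\<^sup>2)"

lemma kernel_mult_vector:
  assumes "t > 0"
  shows "OU_kernel A B S x \<xi> t *v u = Y *v (\<chi> k. h k t x \<xi> * (matrix_inv Y *v u) $ k)"
proof -
  have nz: "l k \<noteq> 0" for k using Re_pos[of k] by auto
  show ?thesis
    unfolding OU_kernel_conj_diag[OF invertible nz assms]
    by (simp only: matrix_vector_mul_assoc[symmetric]) (rule arg_cong[where f = "\<lambda>z. Y *v z"], simp add: vec_eq_iff diag_matrix_vector)
qed

lemma kernel_bound:
  assumes t: "t > 0"
  obtains M \<kappa> where "M > 0" "\<kappa> > 0"
    "\<And>x \<xi> u. norm (OU_kernel A B S x \<xi> t *v u) \<le> M * exp (- \<kappa> * (norm (E t x - \<xi>))\<^sup>2) * norm u"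
proof -
  have "\<exists>M \<kappa>. M \<ge> 0 \<and> \<kappa> > 0 \<and> (\<forall>r. norm (heat_coeff CARD('d) (l k) (m k) t r) = M * exp (- \<kappa> * r))" for k
    using heat_coeff_bound[OF Re_pos[of k] t] by metis
  then obtain M \<kappa> where M: "\<And>k. M k \<ge> 0" and \<kappa>: "\<And>k. \<kappa> k > 0"
    and eq: "\<And>k r. norm (heat_coeff CARD('d) (l k) (m k) t r) = M k * exp (- \<kappa> k * r)"
    by metis
  \<comment> \<open>The slowest of the finitely many decay rates bounds all components at
    once.\<close>
  define \<kappa>0 where "\<kappa>0 = Min (range \<kappa>)"
  have \<kappa>0: "\<kappa>0 > 0" "\<And>k. \<kappa>0 \<le> \<kappa> k" using \<kappa> by (auto simp: \<kappa>0_def)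
  let ?N = "onorm ((*v) Y) * ((\<Sum>k\<in>UNIV. M k) * onorm ((*v) (matrix_inv Y)))"
  have N: "onorm ((*v) Y) \<ge> 0" "onorm ((*v) (matrix_inv Y)) \<ge> 0" "(\<Sum>k\<in>UNIV. M k) \<ge> 0"
    using M by (auto intro!: onorm_pos_le sum_nonneg matrix_vector_mul_bounded_linear)
  show ?thesis
  proof
    \<comment> \<open>The added 1 makes the constant strictly positive, as the Schur test later
      demands of its total mass.\<close>
    show "?N + 1 > 0" using N by (simp add: add_nonneg_pos)
    show "\<kappa>0 > 0" by fact
    fix x \<xi> u
    let ?e = "exp (- \<kappa>0 * (norm (E t x - \<xi>))\<^sup>2)"
    have k: "norm (h k t x \<xi> * (matrix_inv Y *v u) $ k) \<le> M k * ?e * (onorm ((*v) (matrix_inv Y)) * norm u)" for k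
    proof -
      have "norm (h k t x \<xi>) \<le> M k * ?e"
        unfolding eq using M \<kappa>0(2)[of k] by (intro mult_left_mono) (auto intro: mult_right_mono)
      moreover have "norm ((matrix_inv Y *v u) $ k) \<le> onorm ((*v) (matrix_inv Y)) * norm u"
        using Finite_Cartesian_Product.norm_nth_le[of "matrix_inv Y *v u" k] onorm[OF matrix_vector_mul_bounded_linear[of "matrix_inv Y"], of u]
        by linarith
      ultimately show ?thesis
        unfolding norm_mult using M by (intro mult_mono) auto
    qed
    have "norm (OU_kernel A B S x \<xi> t *v u) \<le> onorm ((*v) Y) * norm (\<chi> k. h k t x \<xi> * (matrix_inv Y *v u) $ k)"
      unfolding kernel_mult_vector[OF t] by (rule onorm) simp
    also have "\<dots> \<le> onorm ((*v) Y) * (\<Sum>k\<in>UNIV. norm (h k t x \<xi> * (matrix_inv Y *v u) $ k))"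
      using norm_vec_le_sum[of "\<chi> k. h k t x \<xi> * (matrix_inv Y *v u) $ k"] N by (intro mult_left_mono) simp_all
    also have "\<dots> \<le> onorm ((*v) Y) * (\<Sum>k\<in>UNIV. M k * ?e * (onorm ((*v) (matrix_inv Y)) * norm u))"
      using N k by (intro mult_left_mono sum_mono) auto
    also have "\<dots> = ?N * ?e * norm u"
      by (simp only: sum_distrib_right[symmetric] mult_ac)
    also have "\<dots> \<le> (?N + 1) * ?e * norm u"
      by (intro mult_right_mono) auto
    finally show "norm (OU_kernel A B S x \<xi> t *v u) \<le> (?N + 1) * ?e * norm u" .
  qed
qed

lemma h_measurable [measurable]: "(\<lambda>z. h k t (fst z) (snd z)) \<in> borel_measurable (borel \<Otimes>\<^sub>M borel)"
proof -
  have [measurable]: "heat_coeff CARD('d) a b r \<in> borel_measurable borel" for r a b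
    by (intro borel_measurable_continuous_onI continuous_intros)
  have [measurable]: "E r \<in> borel_measurable borel" for r
    by (intro borel_measurable_continuous_onI continuous_intros)
  show ?thesis by measurable
qed

lemma h_measurable_right [measurable]: "h k t x \<in> borel_measurable borel"
  using measurable_compose[OF measurable_Pair1' h_measurable, of x] by simp

lemma integrand_measurable:
  assumes "v \<in> borel_measurable lebesgue" "t > 0"
  shows "(\<lambda>\<xi>. OU_kernel A B S x \<xi> t *v v \<xi>) \<in> borel_measurable lebesgue"
  unfolding kernel_mult_vector[OF assms(2)]
proof (intro borel_measurable_matrix_vector_mult borel_measurable_vecI)
  fix k
  have [measurable]: "h k t x \<in> borel_measurable lebesgue"
    by (intro measurable_completion) simp
  have [measurable]: "(\<lambda>\<xi>. (matrix_inv Y *v v \<xi>) $ k) \<in> borel_measurable lebesgue"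
    using assms by (intro borel_measurable_vec_nth borel_measurable_matrix_vector_mult)
  show "(\<lambda>\<xi>. (\<chi> k. h k t x \<xi> * (matrix_inv Y *v v \<xi>) $ k) $ k) \<in> borel_measurable lebesgue"
    by simp
qed

lemma kernel_integrable:
  fixes v :: "real ^ 'd \<Rightarrow> complex ^ 'n"
  assumes v: "v \<in> weighted_Lp p \<theta>" and t: "t > 0"
  shows "integrable lebesgue (\<lambda>\<xi>. OU_kernel A B S x \<xi> t *v v \<xi>)"
proof -
  obtain M \<kappa> where M: "M > 0" "\<kappa> > 0"
    "\<And>x \<xi> u. norm (OU_kernel A B S x \<xi> t *v u) \<le> M * exp (- \<kappa> * (norm (E t x - \<xi>))\<^sup>2) * norm u"
    by (rule kernel_bound[OF t]) blast
  have v: "v \<in> borel_measurable lebesgue" "weighted_Lp_norm p \<theta> v < \<infinity>"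
    using v by (simp_all add: weighted_Lp_iff[OF p weight])
  show ?thesis
  proof (rule Bochner_Integration.integrable_bound)
    show "integrable lebesgue (\<lambda>\<xi>. M *\<^sub>R (exp (- \<kappa> * (norm (E t x - \<xi>))\<^sup>2) *\<^sub>R v \<xi>))"
      by (intro integrable_scaleR_right integrable_gaussian_weighted_Lp[OF v(1) p v(2) weight M(2)])
    show "(\<lambda>\<xi>. OU_kernel A B S x \<xi> t *v v \<xi>) \<in> borel_measurable lebesgue"
      by (rule integrand_measurable[OF v(1) t])
    show "AE \<xi> in lebesgue. norm (OU_kernel A B S x \<xi> t *v v \<xi>) \<le> norm (M *\<^sub>R (exp (- \<kappa> * (norm (E t x - \<xi>))\<^sup>2) *\<^sub>R v \<xi>))"
      using M(3)[of x _ "v _"] M(1) by (intro AE_I2) (simp add: mult.assoc)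
  qed
qed

text \<open>Taking a coordinate is bounded and linear, hence commutes with the Bochner integral;
  this is where integrability of the kernel against \<open>v\<close> enters.\<close>

lemma semigroup_conj:
  fixes v :: "real ^ 'd \<Rightarrow> complex ^ 'n"
  assumes v: "v \<in> weighted_Lp p \<theta>" and t: "t > 0"
  shows "(matrix_inv Y *v OU_semigroup A B S t v x) $ k = (\<integral>\<xi>. h k t x \<xi> * (matrix_inv Y *v v \<xi>) $ k \<partial>lebesgue)"
proof -
  let ?f = "\<lambda>\<xi>. OU_kernel A B S x \<xi> t *v v \<xi>"
  have bl: "bounded_linear (\<lambda>z. (matrix_inv Y *v z) $ k)"
    using bounded_linear_compose[OF bounded_linear_vec_nth matrix_vector_mul_bounded_linear] .
  have inv: "matrix_inv Y *v (Y *v z) = z" for z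
    by (simp add: matrix_vector_mul_assoc invertible_matrix_inv[OF invertible])
  have "(matrix_inv Y *v integral\<^sup>L lebesgue ?f) $ k = (\<integral>\<xi>. (matrix_inv Y *v ?f \<xi>) $ k \<partial>lebesgue)"
    by (rule integral_bounded_linear[OF bl kernel_integrable[OF v t], symmetric])
  then show ?thesis
    using t by (simp add: OU_semigroup_def kernel_mult_vector inv)
qed

lemma coordinates_eqI:
  assumes "\<And>k. (matrix_inv Y *v u) $ k = (matrix_inv Y *v w) $ k"
  shows "u = w"
proof -
  have "matrix_inv Y *v u = matrix_inv Y *v w" using assms by (simp add: vec_eq_iff)
  then have "Y *v (matrix_inv Y *v u) = Y *v (matrix_inv Y *v w)" by (simp only:)
  then show ?thesis by (simp add: matrix_vector_mul_assoc invertible_matrix_inv[OF invertible])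
qed

text \<open>The outputs agree as functions, not just almost everywhere: for \<open>t > 0\<close>
  each value is an integral, blind to null sets.\<close>

lemma semigroup_cong:
  fixes v w :: "real ^ 'd \<Rightarrow> complex ^ 'n"
  assumes "v \<in> borel_measurable lebesgue" "w \<in> borel_measurable lebesgue" "t > 0" "AE \<xi> in lebesgue. v \<xi> = w \<xi>"
  shows "OU_semigroup A B S t v = OU_semigroup A B S t w"
proof
  fix x
  have "(\<integral>\<xi>. OU_kernel A B S x \<xi> t *v v \<xi> \<partial>lebesgue) = (\<integral>\<xi>. OU_kernel A B S x \<xi> t *v w \<xi> \<partial>lebesgue)"
    using assms by (intro integral_cong_AE integrand_measurable) auto
  then show "OU_semigroup A B S t v x = OU_semigroup A B S t w x" using assms by (simp add: OU_semigroup_def)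
qed

text \<open>Allows boundedness and the semigroup law to be proved for Borel functions only, since
  norms and operator values carry over unchanged.\<close>

lemma borel_representative:
  fixes v :: "real ^ 'd \<Rightarrow> complex ^ 'n"
  assumes v: "v \<in> weighted_Lp p \<theta>"
  obtains w where "w \<in> borel_measurable borel" "w \<in> weighted_Lp p \<theta>" "weighted_Lp_norm p \<theta> w = weighted_Lp_norm p \<theta> v"
    "\<And>t. t > 0 \<Longrightarrow> OU_semigroup A B S t v = OU_semigroup A B S t w"
proof -
  have vm: "v \<in> borel_measurable lebesgue" using v by (simp add: weighted_Lp_iff[OF p weight])
  obtain w where w: "w \<in> borel_measurable lborel" "AE x in lborel. v x = w x"
    by (rule lebesgue_measurable_borel_representative[OF vm]) blast
  have wm: "w \<in> borel_measurable lebesgue" using w(1) by (rule measurable_completion)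
  have ae: "AE x in lebesgue. v x = w x" using w(2) by (rule AE_completion)
  have [measurable]: "\<theta> \<in> borel_measurable lebesgue"
    using weight_function_measurable[OF weight] by (intro measurable_completion) simp
  have eq: "weighted_Lp_norm p \<theta> w = weighted_Lp_norm p \<theta> v"
    unfolding weighted_Lp_norm_def using vm wm ae by (intro Lp_norm_cong_AE) auto
  show ?thesis
  proof
    show "w \<in> borel_measurable borel" using w(1) by simp
    show "w \<in> weighted_Lp p \<theta>" using v wm eq by (simp add: weighted_Lp_iff[OF p weight])
    show "OU_semigroup A B S t v = OU_semigroup A B S t w" if "t > 0" for t
      by (rule semigroup_cong[OF vm wm that ae])
  qed (rule eq)
qed

lemma semigroup_conj_borel:
  fixes w :: "real ^ 'd \<Rightarrow> complex ^ 'n"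
  assumes w: "w \<in> weighted_Lp p \<theta>" "w \<in> borel_measurable borel" and t: "t > 0"
  shows "(matrix_inv Y *v OU_semigroup A B S t w x) $ k = (\<integral>\<xi>. h k t x \<xi> * (matrix_inv Y *v w \<xi>) $ k \<partial>lborel)"
proof -
  have [measurable]: "(\<lambda>\<xi>. (matrix_inv Y *v w \<xi>) $ k) \<in> borel_measurable borel"
    using w by (intro borel_measurable_vec_nth borel_measurable_matrix_vector_mult)
  show ?thesis
    unfolding semigroup_conj[OF w(1) t] by (rule integral_completion) measurable
qed

text \<open>In the diagonal coordinates the operator is a parameter integral of a jointly Borel
  function, hence measurable in \<open>x\<close>; applying \<open>Y\<close> returns to the original
  coordinates.\<close>

lemma semigroup_measurable:
  fixes w :: "real ^ 'd \<Rightarrow> complex ^ 'n"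
  assumes w: "w \<in> weighted_Lp p \<theta>" "w \<in> borel_measurable borel" and t: "t > 0"
  shows "OU_semigroup A B S t w \<in> borel_measurable borel"
proof -
  have wk[measurable]: "(\<lambda>\<xi>. (matrix_inv Y *v w \<xi>) $ k) \<in> borel_measurable borel" for k
    using w by (intro borel_measurable_vec_nth borel_measurable_matrix_vector_mult)
  have "(\<lambda>x. matrix_inv Y *v OU_semigroup A B S t w x) \<in> borel_measurable borel"
  proof (intro borel_measurable_vecI)
    fix k
    show "(\<lambda>x. (matrix_inv Y *v OU_semigroup A B S t w x) $ k) \<in> borel_measurable borel"
      unfolding semigroup_conj_borel[OF w t]
      by (rule lborel.borel_measurable_lebesgue_integral) (simp add: split_beta)
  qed
  from borel_measurable_matrix_vector_mult[OF this, of Y] show ?thesis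
    by (simp add: matrix_vector_mul_assoc invertible_matrix_inv[OF invertible])
qed

lemma semigroup_bounded:
  assumes t: "t > 0"
  obtains C where "C > 0" "\<And>v :: real ^ 'd \<Rightarrow> complex ^ 'n. v \<in> weighted_Lp p \<theta> \<Longrightarrow>
     OU_semigroup A B S t v \<in> weighted_Lp p \<theta> \<and>
     weighted_Lp_norm p \<theta> (OU_semigroup A B S t v) \<le> ennreal C * weighted_Lp_norm p \<theta> v"
proof -
  obtain M \<kappa> where M: "M > 0" "\<kappa> > 0"
    "\<And>x \<xi> u. norm (OU_kernel A B S x \<xi> t *v u) \<le> M * exp (- \<kappa> * (norm (E t x - \<xi>))\<^sup>2) * norm u"
    by (rule kernel_bound[OF t]) blast
  obtain C where C: "C > 0" "\<And>z \<xi>. \<theta> z * exp (- \<kappa> * (norm (z - \<xi>))\<^sup>2) \<le> C * exp (- (\<kappa> / 2) * (norm (z - \<xi>))\<^sup>2) * \<theta> \<xi>"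
    by (rule weight_gaussian_bound[OF weight M(2)]) blast
  have pos: "\<theta> x > 0" for x using weight by (simp add: weight_function_def)
  have \<theta>E: "\<theta> (E t x) = \<theta> x" for x
    using radial norm_matrix_exp_skew[OF skew, of t x] by (auto simp: radial_def)
  have [measurable]: "\<theta> \<in> borel_measurable borel" by (rule weight_function_measurable[OF weight])
  have [measurable]: "E r \<in> borel_measurable borel" for r
    by (intro borel_measurable_continuous_onI continuous_intros)
  \<comment> \<open>What is left of the kernel once the weight has been moved from \<open>x\<close>
    to \<open>\<xi>\<close>; \<open>K\<close> is its mass in either variable.\<close>
  define k where "k x \<xi> = M * C * exp (- (\<kappa> / 2) * (norm (E t x - \<xi>))\<^sup>2)" for x \<xi>
  define K where "K = M * C * sqrt (pi / (\<kappa> / 2)) ^ DIM(real ^ 'd)"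
  have K: "K > 0" using M C by (simp add: K_def)
  have \<kappa>2: "\<kappa> / 2 > 0" using M by simp
  have km: "case_prod k \<in> borel_measurable (lborel \<Otimes>\<^sub>M lborel)"
    unfolding k_def split_beta by measurable
  have kx: "(\<integral>\<^sup>+\<xi>. ennreal (k x \<xi>) \<partial>lborel) = ennreal K" for x
  proof -
    have "(\<integral>\<^sup>+\<xi>. ennreal (k x \<xi>) \<partial>lborel) = (\<integral>\<^sup>+\<xi>. ennreal (M * C) * ennreal (exp (- (\<kappa> / 2) * (norm (\<xi> - E t x))\<^sup>2)) \<partial>lborel)"
      using M C by (simp add: k_def ennreal_mult norm_minus_commute)
    also have "\<dots> = ennreal K"
      using M C by (subst nn_integral_cmult) (simp_all only: nn_integral_gaussian_shifted[OF \<kappa>2] K_def, simp_all add: ennreal_mult)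
    finally show ?thesis .
  qed
  have k\<xi>: "(\<integral>\<^sup>+x. ennreal (k x \<xi>) \<partial>lborel) = ennreal K" for \<xi>
  proof -
    have "(\<integral>\<^sup>+x. ennreal (k x \<xi>) \<partial>lborel) = (\<integral>\<^sup>+x. ennreal (M * C) * ennreal (exp (- (\<kappa> / 2) * (norm (x - E (- t) \<xi>))\<^sup>2)) \<partial>lborel)"
      using M C by (simp add: k_def ennreal_mult norm_matrix_exp_skew_diff[OF skew])
    also have "\<dots> = ennreal K"
      using M C by (subst nn_integral_cmult) (simp_all only: nn_integral_gaussian_shifted[OF \<kappa>2] K_def, simp_all add: ennreal_mult)
    finally show ?thesis .
  qed
  \<comment> \<open>Borel functions come first, because the Schur test runs over products of
    \<open>lborel\<close>.\<close>
  have main: "OU_semigroup A B S t w \<in> weighted_Lp p \<theta> \<and>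
     weighted_Lp_norm p \<theta> (OU_semigroup A B S t w) \<le> ennreal K * weighted_Lp_norm p \<theta> w"
    if w: "w \<in> weighted_Lp p \<theta>" "w \<in> borel_measurable borel" for w :: "real ^ 'd \<Rightarrow> complex ^ 'n"
  proof -
    have [measurable]: "w \<in> borel_measurable borel" by fact
    have Tm[measurable]: "OU_semigroup A B S t w \<in> borel_measurable borel"
      by (rule semigroup_measurable[OF w t])
    have le: "weighted_Lp_norm p \<theta> (OU_semigroup A B S t w) \<le> ennreal K * weighted_Lp_norm p \<theta> w"
      unfolding weighted_Lp_norm_def
    proof (rule Lp_norm_schur[OF km _ _ _ K kx k\<xi> p])
      show "(\<lambda>x. \<theta> x *\<^sub>R w x) \<in> borel_measurable lborel" by simp
      show "(\<lambda>x. \<theta> x *\<^sub>R OU_semigroup A B S t w x) \<in> borel_measurable lebesgue"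
        by (intro measurable_completion) simp
      show "k x \<xi> \<ge> 0" for x \<xi> using M C by (simp add: k_def)
      fix x
      have "ennreal (norm (\<theta> x *\<^sub>R OU_semigroup A B S t w x)) = ennreal (\<theta> x) * ennreal (norm (\<integral>\<xi>. OU_kernel A B S x \<xi> t *v w \<xi> \<partial>lebesgue))"
        using pos[of x] t by (simp add: OU_semigroup_def ennreal_mult)
      also have "\<dots> \<le> ennreal (\<theta> x) * (\<integral>\<^sup>+\<xi>. ennreal (norm (OU_kernel A B S x \<xi> t *v w \<xi>)) \<partial>lebesgue)"
        by (intro mult_left_mono integral_norm_bound_ennreal kernel_integrable[OF w(1) t]) simp
      also have "\<dots> \<le> ennreal (\<theta> x) * (\<integral>\<^sup>+\<xi>. ennreal (M * exp (- \<kappa> * (norm (E t x - \<xi>))\<^sup>2) * norm (w \<xi>)) \<partial>lebesgue)"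
        by (intro mult_left_mono nn_integral_mono ennreal_leI M) simp
      also have "\<dots> = ennreal (\<theta> x) * (\<integral>\<^sup>+\<xi>. ennreal (M * exp (- \<kappa> * (norm (E t x - \<xi>))\<^sup>2) * norm (w \<xi>)) \<partial>lborel)"
        by (simp only: nn_integral_completion)
      also have "\<dots> = (\<integral>\<^sup>+\<xi>. ennreal (\<theta> x) * ennreal (M * exp (- \<kappa> * (norm (E t x - \<xi>))\<^sup>2) * norm (w \<xi>)) \<partial>lborel)"
        by (rule nn_integral_cmult[symmetric]) measurable
      also have "\<dots> \<le> (\<integral>\<^sup>+\<xi>. ennreal (k x \<xi> * norm (\<theta> \<xi> *\<^sub>R w \<xi>)) \<partial>lborel)"
      proof (rule nn_integral_mono)
        fix \<xi>
        \<comment> \<open>The weight at \<open>x\<close> is read as the weight at the centre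
          \<open>E t x\<close> of the Gaussian, the point at which the growth bound compares it with
          \<open>\<theta> \<xi>\<close>.\<close>
        have "\<theta> x * (M * exp (- \<kappa> * (norm (E t x - \<xi>))\<^sup>2) * norm (w \<xi>)) =
           M * norm (w \<xi>) * (\<theta> (E t x) * exp (- \<kappa> * (norm (E t x - \<xi>))\<^sup>2))"
          by (simp only: \<theta>E mult_ac)
        also have "\<dots> \<le> M * norm (w \<xi>) * (C * exp (- (\<kappa> / 2) * (norm (E t x - \<xi>))\<^sup>2) * \<theta> \<xi>)"
          using M(1) by (intro mult_left_mono C) auto
        also have "\<dots> = k x \<xi> * norm (\<theta> \<xi> *\<^sub>R w \<xi>)"
          using pos[of \<xi>] by (simp add: k_def)
        finally show "ennreal (\<theta> x) * ennreal (M * exp (- \<kappa> * (norm (E t x - \<xi>))\<^sup>2) * norm (w \<xi>)) \<le>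
            ennreal (k x \<xi> * norm (\<theta> \<xi> *\<^sub>R w \<xi>))"
          using pos[of x] M(1) by (subst ennreal_mult[symmetric]) (auto intro: ennreal_leI)
      qed
      finally show "ennreal (norm (\<theta> x *\<^sub>R OU_semigroup A B S t w x)) \<le> (\<integral>\<^sup>+\<xi>. ennreal (k x \<xi> * norm (\<theta> \<xi> *\<^sub>R w \<xi>)) \<partial>lborel)" .
    qed
    also have "\<dots> < \<infinity>" using w(1) by (simp add: weighted_Lp_def ennreal_mult_less_top)
    finally have "weighted_Lp_norm p \<theta> (OU_semigroup A B S t w) < \<infinity>" .
    moreover have "OU_semigroup A B S t w \<in> borel_measurable lebesgue"
      by (intro measurable_completion) simp
    ultimately show ?thesis using le by (simp add: weighted_Lp_iff[OF p weight])
  qed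
  show ?thesis
  proof
    show "K > 0" by (rule K)
    fix v :: "real ^ 'd \<Rightarrow> complex ^ 'n"
    assume "v \<in> weighted_Lp p \<theta>"
    then obtain w where "w \<in> borel_measurable borel" "w \<in> weighted_Lp p \<theta>" "weighted_Lp_norm p \<theta> w = weighted_Lp_norm p \<theta> v"
      "OU_semigroup A B S t v = OU_semigroup A B S t w"
      by (rule borel_representative) (use t in blast)
    then show "OU_semigroup A B S t v \<in> weighted_Lp p \<theta> \<and>
       weighted_Lp_norm p \<theta> (OU_semigroup A B S t v) \<le> ennreal K * weighted_Lp_norm p \<theta> v"
      using main[of w] by simp
  qed
qed

lemma semigroup_zero: "OU_semigroup A B S 0 v = v"
  by (simp add: OU_semigroup_def fun_eq_iff)

lemma linear_operator:
  assumes "t \<ge> 0"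
  shows "linear_operator_on_Lp p \<theta> (OU_semigroup A B S t)"
proof (cases "t = 0")
  case True
  then show ?thesis by (simp add: linear_operator_on_Lp_def ae_equal_def semigroup_zero)
next
  case False
  then have t: "t > 0" using assms by simp
  have meas: "v \<in> borel_measurable lebesgue" if "v \<in> weighted_Lp p \<theta>" for v :: "real ^ 'd \<Rightarrow> complex ^ 'n"
    using that by (simp add: weighted_Lp_iff[OF p weight])
  show ?thesis
    unfolding linear_operator_on_Lp_def
  proof (intro conjI ballI allI impI)
    fix v :: "real ^ 'd \<Rightarrow> complex ^ 'n" assume v: "v \<in> weighted_Lp p \<theta>"
    show "OU_semigroup A B S t v \<in> weighted_Lp p \<theta>"
      using semigroup_bounded[OF t] v by blast
    show "ae_equal (OU_semigroup A B S t (\<lambda>x. c *s v x)) (\<lambda>x. c *s OU_semigroup A B S t v x)" for c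
    proof -
      have bl: "bounded_linear (\<lambda>z :: complex ^ 'n. c *s z)"
        unfolding linear_conv_bounded_linear[symmetric]
        by (rule linearI) (simp_all add: vec_eq_iff algebra_simps)
      have "OU_semigroup A B S t (\<lambda>x. c *s v x) x = c *s OU_semigroup A B S t v x" for x
        using integral_bounded_linear[OF bl kernel_integrable[OF v t, of x]] t
        by (simp add: OU_semigroup_def vector_scalar_commute)
      then show ?thesis by (simp add: ae_equal_def)
    qed
    fix w :: "real ^ 'd \<Rightarrow> complex ^ 'n" assume w: "w \<in> weighted_Lp p \<theta>"
    show "ae_equal (OU_semigroup A B S t v) (OU_semigroup A B S t w)" if "ae_equal v w"
      using semigroup_cong[OF meas[OF v] meas[OF w] t] that by (simp add: ae_equal_def)
    \<comment> \<open>Additivity needs both integrands to be integrable, since a non-integrable one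
      would contribute the default value 0.\<close>
    show "ae_equal (OU_semigroup A B S t (\<lambda>x. v x + w x)) (\<lambda>x. OU_semigroup A B S t v x + OU_semigroup A B S t w x)"
      using kernel_integrable[OF v t] kernel_integrable[OF w t] t
      by (simp add: ae_equal_def OU_semigroup_def matrix_vector_right_distrib)
  qed
qed

lemma bounded_operator:
  assumes "t \<ge> 0"
  shows "bounded_operator_on_Lp p \<theta> (OU_semigroup A B S t)"
proof (cases "t = 0")
  case True
  then show ?thesis
    unfolding bounded_operator_on_Lp_def by (intro exI[of _ 1]) (simp add: semigroup_zero)
next
  case False
  then have t: "t > 0" using assms by simp
  show ?thesis
    by (rule semigroup_bounded[OF t]) (unfold bounded_operator_on_Lp_def, meson less_imp_le)
qed

text \<open>Equality holds at every point. It is checked in the diagonal coordinates of a Borel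
  representative, where it is the scalar Chapman-Kolmogorov identity with kernel
  \<open>h k\<close>.\<close>

lemma semigroup_law:
  fixes v :: "real ^ 'd \<Rightarrow> complex ^ 'n"
  assumes v: "v \<in> weighted_Lp p \<theta>" and s: "s > 0" and t: "t > 0"
  shows "OU_semigroup A B S t (OU_semigroup A B S s v) = OU_semigroup A B S (t + s) v"
proof -
  obtain w where w: "w \<in> borel_measurable borel" "w \<in> weighted_Lp p \<theta>"
    and T: "\<And>t. t > 0 \<Longrightarrow> OU_semigroup A B S t v = OU_semigroup A B S t w"
    by (rule borel_representative[OF v]) blast
  let ?w = "\<lambda>k \<xi>. (matrix_inv Y *v w \<xi>) $ k"
  have wk: "?w k \<in> borel_measurable borel" for k
    using w by (intro borel_measurable_vec_nth borel_measurable_matrix_vector_mult)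
  have Tw: "OU_semigroup A B S s w \<in> weighted_Lp p \<theta>" "OU_semigroup A B S s w \<in> borel_measurable borel"
    using semigroup_bounded[OF s] semigroup_measurable[OF w(2,1) s] w(2) by blast+
  have bl: "bounded_linear (\<lambda>z. (matrix_inv Y *v z) $ k)" for k
    using bounded_linear_compose[OF bounded_linear_vec_nth matrix_vector_mul_bounded_linear] .
  \<comment> \<open>All centres and rates are required, because the dominating function in the
    exchange of integrals has a centre and a rate of its own.\<close>
  have int: "integrable lborel (\<lambda>\<xi>. exp (- \<kappa> * (norm (z - \<xi>))\<^sup>2) *\<^sub>R ?w k \<xi>)" if \<kappa>: "\<kappa> > 0" for z \<kappa> k
  proof -
    have "integrable lebesgue (\<lambda>\<xi>. exp (- \<kappa> * (norm (z - \<xi>))\<^sup>2) *\<^sub>R w \<xi>)"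
      using w(2) by (intro integrable_gaussian_weighted_Lp[OF _ p _ weight \<kappa>]) (simp_all add: weighted_Lp_iff[OF p weight])
    from integrable_bounded_linear[OF bl[of k] this]
    have "integrable lebesgue (\<lambda>\<xi>. exp (- \<kappa> * (norm (z - \<xi>))\<^sup>2) *\<^sub>R ?w k \<xi>)"
      by (simp only: matrix_vector_mult_scaleR_complex vector_scaleR_component)
    then show ?thesis
      using wk[of k] by (subst (asm) integrable_completion) auto
  qed
  have "OU_semigroup A B S t (OU_semigroup A B S s w) x = OU_semigroup A B S (t + s) w x" for x
  proof (rule coordinates_eqI)
    fix k
    have "(matrix_inv Y *v OU_semigroup A B S t (OU_semigroup A B S s w) x) $ k =
       (\<integral>\<xi>. h k t x \<xi> * (\<integral>y. h k s \<xi> y * ?w k y \<partial>lborel) \<partial>lborel)"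
      unfolding semigroup_conj_borel[OF Tw t] semigroup_conj_borel[OF w(2,1) s] ..
    also have "\<dots> = (\<integral>y. h k (t + s) x y * ?w k y \<partial>lborel)"
      by (rule heat_coeff_Chapman_Kolmogorov[OF skew Re_pos s t wk int])
    also have "\<dots> = (matrix_inv Y *v OU_semigroup A B S (t + s) w x) $ k"
      using s t by (simp add: semigroup_conj_borel[OF w(2,1)])
    finally show "(matrix_inv Y *v OU_semigroup A B S t (OU_semigroup A B S s w) x) $ k =
      (matrix_inv Y *v OU_semigroup A B S (t + s) w x) $ k" .
  qed
  then show ?thesis using s t by (simp only: T add_pos_pos fun_eq_iff simp_thms)
qed

end

text \<open>The integrability conjunct ensures that the operators are given by genuine integrals and
  not by the default value 0. Equalities are asserted almost everywhere, as elements of the space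
  are classes of functions.\<close>

theorem theorem5p2:
  fixes A B :: "complex ^ 'n ^ 'n"
    and S :: "real ^ 'd ^ 'd"
    and p :: ennreal
    and \<theta> :: "real ^ 'd \<Rightarrow> real"
    and \<eta> :: real
  assumes "CARD('d) \<ge> 2"
    and "simultaneously_diagonalizable A B"
    and "\<And>z. eigenvalue A z \<Longrightarrow> Re z > 0"
    and "transpose S = - S"
    and "1 \<le> p"
    and "weight_function \<theta> \<eta>"
    and "radial \<theta>"
  shows "(\<forall>t>0. \<forall>v \<in> weighted_Lp p \<theta>. \<forall>x.
            integrable lebesgue (\<lambda>\<xi>. OU_kernel A B S x \<xi> t *v v \<xi>)) \<and>
         (\<forall>t\<ge>0. linear_operator_on_Lp p \<theta> (OU_semigroup A B S t) \<and>
                 bounded_operator_on_Lp p \<theta> (OU_semigroup A B S t)) \<and>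
         (\<forall>v \<in> weighted_Lp p \<theta>. ae_equal (OU_semigroup A B S 0 v) v) \<and>
         (\<forall>s\<ge>0. \<forall>t\<ge>0. \<forall>v \<in> weighted_Lp p \<theta>.
            ae_equal (OU_semigroup A B S t (OU_semigroup A B S s v)) (OU_semigroup A B S (t + s) v))"
proof -
  obtain Y :: "complex ^ 'n ^ 'n" and l m where Y: "invertible Y"
    and A: "A = Y ** diag_matrix l ** matrix_inv Y" and B: "B = Y ** diag_matrix m ** matrix_inv Y"
    using assms(2) by (auto simp: simultaneously_diagonalizable_def)
  interpret OU_system Y l m S p \<theta> \<eta>
    using assms Y eigenvalue_conj_diag[OF Y] by unfold_locales (auto simp: A)
  note T0 = semigroup_zero[folded A B]
  \<comment> \<open>At time zero the operator returns the function itself, so only two positive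
    times need the convolution argument.\<close>
  have "OU_semigroup A B S t (OU_semigroup A B S s v) = OU_semigroup A B S (t + s) v"
    if "s \<ge> 0" "t \<ge> 0" "v \<in> weighted_Lp p \<theta>" for s t v
    using that semigroup_law[of v s t, folded A B] by (cases "s = 0"; cases "t = 0") (simp_all add: T0)
  then show ?thesis
    using kernel_integrable[folded A B] linear_operator[folded A B] bounded_operator[folded A B]
    by (simp add: T0 ae_equal_def)
qed

end
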